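(* Let $(M,\Omega,\mathbb{T},\mu)$ be a compact toric symplectic manifold and $J_+\in DGK_\Omega^{\mathbb{T}}(M)$. Let $J_0$ be the complex structure on $\mathring M$ induced by the generalized complexified torus action, i.e. $J_0X_j=Y_j$, $J_0Y_j=-X_j$, where $Y_j=J_+(X_j-g^{-1}b(X_j))$, and let $J_0'$ be the average of $J_+$ and $J_-$ on $\mathring M$, i.e. the complex structure given in admissible coordinates $(\theta_j,\mu_j)$ associated to $J_+$ by $$J_0'\partial_{\theta_k}=-\sum_j\big((\phi_s)^{-1}\big)_{kj}\partial_{\mu_j},\qquad J_0'\partial_{\mu_k}=\sum_j(\phi_s)_{kj}\partial_{\theta_j}.$$ Then on $\mathring M$ the complex structures $J_0$ and $J_0'$ coincide. In particular, the Kähler form $\omega(\cdot,\cdot)=\tilde g(J_0\,\cdot,\cdot)$ on $\mathring M$, where $\tilde g$ is the metric defined, with $X_j^+=X_j-g^{-1}b(X_j)$, by $$\tilde g(X_j,X_k)=\tilde g(Y_j,Y_k)=g(X_j^+,X_k^+),\qquad \tilde g(X_j,Y_k)=g(X_j,Y_k),$$ coincides with $\Omega$.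
   Context: Setting. $M$ is a compact connected manifold of dimension $2n$ with symplectic form $\Omega$ and an effective Hamiltonian action of the torus $\mathbb{T}=\mathbb{T}^n$ with moment map $\mu:M\to\mathfrak{t}^*$. Fix a basis $\{e_j\}$ of $\mathfrak{t}$, let $X_j$ be the fundamental vector fields and $\mu_j$ the components of $\mu$; convention $\iota_{X_j}\Omega=-d\mu_j$. $\Delta=\mu(M)$ is the moment polytope, $\mathring\Delta$ its interior, $\mathring M=\mu^{-1}(\mathring\Delta)$. Conventions. 2-forms and metrics are regarded as maps $TM\to T^*M$, $X\mapsto\iota_X(\cdot)$; $(J^*\alpha)(X)=\alpha(JX)$. $GK_\Omega^{\mathbb T}(M)$ is the set of $\mathbb{T}$-invariant integrable complex structures $J_+$ on $M$ that are tamed by $\Omega$ (i.e. $\Omega(X,J_+X)>0$ for $X\ne0$) and for which $J_-:=-\Omega^{-1}J_+^*\Omega$ is also integrable (these parametrize $\mathbb{T}$-invariant generalized Kähler structures of symplectic type). Put $g=-\frac12\Omega(J_++J_-)$ (a Riemannian metric) and $b=-\frac12\Omega(J_+-J_-)$ (a 2-form). $DGK_\Omega^{\mathbb T}(M)$ is the subset with $J_+\mathcal D=J_-\mathcal D$ on $\mathring M$, where $\mathcal D=\mathrm{span}\{X_j\}$. Admissible coordinates. For $J_+\in DGK_\Omega^{\mathbb T}(M)$, $\{X_j,J_+X_j\}$ is a frame on $\mathring M$; the first half $\{\zeta_j\}$ of the dual coframe is closed, locally $\zeta_j=d\theta_j$, and $(\theta_j,\mu_j)$ are coordinates on $\mathring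 M$ with $\partial_{\theta_j}=X_j$ and $\Omega=\sum_j d\mu_j\wedge d\theta_j$, called admissible coordinates associated to $J_+$. In them $J_+\partial_{\mu_k}=\sum_j\phi_{kj}\partial_{\theta_j}$ and $J_-\partial_{\mu_k}=\sum_j\phi_{jk}\partial_{\theta_j}$, where $\phi$ is a matrix function of $\mu\in\mathring\Delta$ whose symmetric part $\phi_s=(\phi+\phi^T)/2$ is the positive-definite Hessian of a function $\tau$ on $\mathring\Delta$ and whose anti-symmetric part $\phi_a=(\phi-\phi^T)/2$ is constant. *)

theory Defs
  imports "HOL-Analysis.Analysis"
begin

section \<open>Smooth manifolds\<close>

text \<open>
  The manifold is a whole type \<open>'a\<close>, carrying its topology as a type class, together with a smooth
  atlas with values in a Euclidean space \<open>'e\<close>. A chart is a pair of its domain and its coordinate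
  map.

  The tangent space at a point \<open>p\<close> is the model space \<open>'e\<close>: a tangent vector is an equivalence class
  of pairs (chart at \<open>p\<close>, vector of \<open>'e\<close>), and it is represented by its unique member whose first
  component is the preferred chart \<open>chart_at A p\<close>. Hence vector fields, endomorphism fields and
  2-forms have the types \<open>'a \<Rightarrow> 'e\<close>, \<open>'a \<Rightarrow> 'e \<Rightarrow> 'e\<close> and \<open>'a \<Rightarrow> 'e \<Rightarrow> 'e \<Rightarrow> real\<close>. As the preferred
  chart varies discontinuously with the point, smoothness is always tested in the charts of the
  atlas.
\<close>

type_synonym ('a, 'e) chart = "'a set \<times> ('a \<Rightarrow> 'e)"

text \<open>The domain \<open>S\<close> is always meant to be open.\<close>

primrec ck_on :: "nat \<Rightarrow> ('v::real_normed_vector \<Rightarrow> 'w::real_normed_vector) \<Rightarrow> 'v set \<Rightarrow> bool" where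
  "ck_on 0 f S \<longleftrightarrow> continuous_on S f"
| "ck_on (Suc k) f S \<longleftrightarrow>
     (\<forall>x\<in>S. f differentiable (at x)) \<and> (\<forall>v. ck_on k (\<lambda>x. frechet_derivative f (at x) v) S)"

definition smooth_on :: "('v::real_normed_vector \<Rightarrow> 'w::real_normed_vector) \<Rightarrow> 'v set \<Rightarrow> bool" where
  "smooth_on f S \<longleftrightarrow> (\<forall>k. ck_on k f S)"

definition chart_inv :: "('a, 'e) chart \<Rightarrow> 'e \<Rightarrow> 'a" where
  "chart_inv c = inv_into (fst c) (snd c)"

definition smooth_atlas ::
  "('a::{t2_space,second_countable_topology}, 'e::euclidean_space) chart set \<Rightarrow> bool" where
  "smooth_atlas A \<longleftrightarrow>
     (\<Union>c\<in>A. fst c) = UNIV \<and>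
     (\<forall>c\<in>A. open (fst c) \<and> open (snd c ` fst c) \<and>
            homeomorphism (fst c) (snd c ` fst c) (snd c) (chart_inv c)) \<and>
     (\<forall>c\<in>A. \<forall>d\<in>A. smooth_on (snd d \<circ> chart_inv c) (snd c ` (fst c \<inter> fst d)))"

definition chart_at :: "('a, 'e) chart set \<Rightarrow> 'a \<Rightarrow> ('a, 'e) chart" where
  "chart_at A p = (SOME c. c \<in> A \<and> p \<in> fst c)"

definition smooth_fun ::
  "('a, 'e::euclidean_space) chart set \<Rightarrow> 'a set \<Rightarrow> ('a \<Rightarrow> 'w::real_normed_vector) \<Rightarrow> bool" where
  "smooth_fun A U f \<longleftrightarrow> (\<forall>c\<in>A. smooth_on (f \<circ> chart_inv c) (snd c ` (U \<inter> fst c)))"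

text \<open>
  \<open>mderiv A f p v\<close> is \<open>df\<^sub>p(v)\<close> for a function \<open>f\<close> with values in a normed space. For a coordinate map
  \<open>x\<close> near \<open>p\<close>, \<open>mderiv A x p v\<close> is the vector of the components of \<open>v\<close> in the coordinates \<open>x\<close>.
\<close>

definition mderiv ::
  "('a, 'e::euclidean_space) chart set \<Rightarrow> ('a \<Rightarrow> 'w::real_normed_vector) \<Rightarrow> 'a \<Rightarrow> 'e \<Rightarrow> 'w" where
  "mderiv A f p =
     frechet_derivative (f \<circ> chart_inv (chart_at A p)) (at (snd (chart_at A p) p))"

text \<open>The tangent map \<open>T\<^sub>pM \<rightarrow> T\<^sub>f\<^sub>(\<^sub>p\<^sub>)M\<close> of a map \<open>f : M \<rightarrow> M\<close>.\<close>

definition tangent_map ::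
  "('a, 'e::euclidean_space) chart set \<Rightarrow> ('a \<Rightarrow> 'a) \<Rightarrow> 'a \<Rightarrow> 'e \<Rightarrow> 'e" where
  "tangent_map A f p = mderiv A (snd (chart_at A (f p)) \<circ> f) p"

text \<open>
  \<open>coord_vec A x p v\<close> is the tangent vector at \<open>p\<close> whose components in the coordinates \<open>x\<close> are \<open>v\<close>; for
  a basis vector \<open>v\<close> of the model space it is a coordinate vector field of \<open>x\<close>.
\<close>

definition coord_vec ::
  "('a, 'e::euclidean_space) chart set \<Rightarrow> ('a \<Rightarrow> 'f::euclidean_space) \<Rightarrow> 'a \<Rightarrow> 'f \<Rightarrow> 'e" where
  "coord_vec A x p v = inv (mderiv A x p) v"

definition local_coordinates ::
  "('a::{t2_space,second_countable_topology}, 'e::euclidean_space) chart set \<Rightarrow>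
     'a set \<Rightarrow> ('a \<Rightarrow> 'f::euclidean_space) \<Rightarrow> bool" where
  "local_coordinates A U x \<longleftrightarrow>
     open U \<and> open (x ` U) \<and> homeomorphism U (x ` U) x (inv_into U x) \<and>
     smooth_fun A U x \<and>
     (\<forall>c\<in>A. smooth_on (snd c \<circ> inv_into U x) (x ` (U \<inter> fst c)))"

definition smooth_vf :: "('a, 'e::euclidean_space) chart set \<Rightarrow> ('a \<Rightarrow> 'e) \<Rightarrow> bool" where
  "smooth_vf A X \<longleftrightarrow> (\<forall>c\<in>A. smooth_fun A (fst c) (\<lambda>p. mderiv A (snd c) p (X p)))"

text \<open>
  \<open>[X, Y] = DY(X) - DX(Y)\<close> in the preferred chart at \<open>p\<close>, in which components and tangent vectors at
  \<open>p\<close> agree.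
\<close>

definition lie_bracket ::
  "('a, 'e::euclidean_space) chart set \<Rightarrow> ('a \<Rightarrow> 'e) \<Rightarrow> ('a \<Rightarrow> 'e) \<Rightarrow> 'a \<Rightarrow> 'e" where
  "lie_bracket A X Y p =
     mderiv A (\<lambda>q. mderiv A (snd (chart_at A p)) q (Y q)) p (X p) -
     mderiv A (\<lambda>q. mderiv A (snd (chart_at A p)) q (X q)) p (Y p)"

section \<open>Symplectic forms and complex structures\<close>

definition smooth_2form ::
  "('a, 'e::euclidean_space) chart set \<Rightarrow> ('a \<Rightarrow> 'e \<Rightarrow> 'e \<Rightarrow> real) \<Rightarrow> bool" where
  "smooth_2form A \<Omega> \<longleftrightarrow>
     (\<forall>p. bilinear (\<Omega> p) \<and> (\<forall>u v. \<Omega> p u v = - \<Omega> p v u)) \<and>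
     (\<forall>c\<in>A. \<forall>v w. smooth_fun A (fst c)
        (\<lambda>p. \<Omega> p (coord_vec A (snd c) p v) (coord_vec A (snd c) p w)))"

text \<open>The exterior derivative is written in the invariant form with vector fields.\<close>

definition closed_2form ::
  "('a, 'e::euclidean_space) chart set \<Rightarrow> ('a \<Rightarrow> 'e \<Rightarrow> 'e \<Rightarrow> real) \<Rightarrow> bool" where
  "closed_2form A \<Omega> \<longleftrightarrow>
     (\<forall>X Y Z p. smooth_vf A X \<and> smooth_vf A Y \<and> smooth_vf A Z \<longrightarrow>
        mderiv A (\<lambda>q. \<Omega> q (Y q) (Z q)) p (X p) +
        mderiv A (\<lambda>q. \<Omega> q (Z q) (X q)) p (Y p) +
        mderiv A (\<lambda>q. \<Omega> q (X q) (Y q)) p (Z p) -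
        \<Omega> p (lie_bracket A X Y p) (Z p) -
        \<Omega> p (lie_bracket A Y Z p) (X p) -
        \<Omega> p (lie_bracket A Z X p) (Y p) = 0)"

definition symplectic_form ::
  "('a, 'e::euclidean_space) chart set \<Rightarrow> ('a \<Rightarrow> 'e \<Rightarrow> 'e \<Rightarrow> real) \<Rightarrow> bool" where
  "symplectic_form A \<Omega> \<longleftrightarrow>
     smooth_2form A \<Omega> \<and> closed_2form A \<Omega> \<and>
     (\<forall>p u. (\<forall>v. \<Omega> p u v = 0) \<longrightarrow> u = 0)"

definition almost_complex_structure ::
  "('a, 'e::euclidean_space) chart set \<Rightarrow> ('a \<Rightarrow> 'e \<Rightarrow> 'e) \<Rightarrow> bool" where
  "almost_complex_structure A J \<longleftrightarrow>
     (\<forall>p. linear (J p) \<and> (\<forall>v. J p (J p v) = - v)) \<and>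
     (\<forall>c\<in>A. \<forall>v. smooth_fun A (fst c)
        (\<lambda>p. mderiv A (snd c) p (J p (coord_vec A (snd c) p v))))"

text \<open>Integrability is the vanishing of the Nijenhuis tensor.\<close>

definition integrable_complex_structure ::
  "('a, 'e::euclidean_space) chart set \<Rightarrow> ('a \<Rightarrow> 'e \<Rightarrow> 'e) \<Rightarrow> bool" where
  "integrable_complex_structure A J \<longleftrightarrow>
     almost_complex_structure A J \<and>
     (\<forall>X Y p. smooth_vf A X \<and> smooth_vf A Y \<longrightarrow>
        lie_bracket A (\<lambda>q. J q (X q)) (\<lambda>q. J q (Y q)) p
        - J p (lie_bracket A (\<lambda>q. J q (X q)) Y p)
        - J p (lie_bracket A X (\<lambda>q. J q (Y q)) p)
        - lie_bracket A X Y p = 0)"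

section \<open>Toric symplectic manifolds\<close>

text \<open>
  The torus \<open>T\<^sup>n\<close> consists of the vectors of \<open>n\<close> complex numbers of modulus one, with the componentwise
  product and unit \<open>1\<close> of \<open>complex ^ 'n\<close>. Its Lie algebra is \<open>real ^ 'n\<close>, with exponential map
  \<open>torus_exp\<close>, and the dual of the Lie algebra is the space of (bounded) linear functionals
  \<open>(real ^ 'n) \<Rightarrow>\<^sub>L real\<close>.
\<close>

definition torus :: "(complex ^ 'n) set" where
  "torus = {t. \<forall>j. cmod (t $ j) = 1}"

definition torus_exp :: "real ^ 'n \<Rightarrow> complex ^ 'n" where
  "torus_exp \<xi> = (\<chi> j. cis (\<xi> $ j))"

text \<open>
  As \<open>torus_exp\<close> is a surjective local diffeomorphism and a homomorphism, smoothness of the action on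
  \<open>T\<^sup>n \<times> M\<close> is smoothness of its composition with \<open>torus_exp\<close>.
\<close>

definition smooth_torus_action ::
  "('a::{t2_space,second_countable_topology}, 'e::euclidean_space) chart set \<Rightarrow>
     (complex ^ 'n \<Rightarrow> 'a \<Rightarrow> 'a) \<Rightarrow> bool" where
  "smooth_torus_action A act \<longleftrightarrow>
     (\<forall>p. act 1 p = p) \<and>
     (\<forall>s\<in>torus. \<forall>t\<in>torus. \<forall>p. act (s * t) p = act s (act t p)) \<and>
     continuous_on UNIV (\<lambda>(\<xi>, p). act (torus_exp \<xi>) p) \<and>
     (\<forall>c\<in>A. \<forall>d\<in>A. smooth_on
        (\<lambda>(\<xi>, y). snd d (act (torus_exp \<xi>) (chart_inv c y)))
        {(\<xi>, y). y \<in> snd c ` fst c \<and> act (torus_exp \<xi>) (chart_inv c y) \<in> fst d})"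

definition effective_torus_action :: "(complex ^ 'n \<Rightarrow> 'a \<Rightarrow> 'a) \<Rightarrow> bool" where
  "effective_torus_action act \<longleftrightarrow> (\<forall>t\<in>torus. (\<forall>p. act t p = p) \<longrightarrow> t = 1)"

text \<open>The fundamental vector field of \<open>\<xi>\<close>: the velocity at \<open>s = 0\<close> of \<open>exp(s\<xi>) \<cdot> p\<close>.\<close>

definition fund_vf ::
  "('a, 'e::euclidean_space) chart set \<Rightarrow> (complex ^ 'n \<Rightarrow> 'a \<Rightarrow> 'a) \<Rightarrow> real ^ 'n \<Rightarrow> 'a \<Rightarrow> 'e" where
  "fund_vf A act \<xi> p =
     vector_derivative (\<lambda>s. snd (chart_at A p) (act (torus_exp (s *\<^sub>R \<xi>)) p)) (at 0)"

text \<open>Sign convention for moment maps: \<open>\<iota>\<^bsub>X\<^esub>\<Omega> = - d\<mu>\<^sub>\<xi>\<close>, where \<open>X\<close> is the fundamental field of \<open>\<xi>\<close>.\<close>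

definition hamiltonian_torus_action ::
  "('a::{t2_space,second_countable_topology}, 'e::euclidean_space) chart set \<Rightarrow>
     ('a \<Rightarrow> 'e \<Rightarrow> 'e \<Rightarrow> real) \<Rightarrow> (complex ^ 'n \<Rightarrow> 'a \<Rightarrow> 'a) \<Rightarrow> ('a \<Rightarrow> (real ^ 'n) \<Rightarrow>\<^sub>L real) \<Rightarrow> bool" where
  "hamiltonian_torus_action A \<Omega> act \<mu> \<longleftrightarrow>
     smooth_torus_action A act \<and>
     (\<forall>t\<in>torus. \<forall>p u v.
        \<Omega> (act t p) (tangent_map A (act t) p u) (tangent_map A (act t) p v) = \<Omega> p u v) \<and>
     smooth_fun A UNIV \<mu> \<and>
     (\<forall>t\<in>torus. \<forall>p. \<mu> (act t p) = \<mu> p) \<and>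
     (\<forall>\<xi> p v. \<Omega> p (fund_vf A act \<xi> p) v = - mderiv A (\<lambda>q. blinfun_apply (\<mu> q) \<xi>) p v)"

definition compact_toric_symplectic_manifold ::
  "('a::{t2_space,second_countable_topology}, 'e::euclidean_space) chart set \<Rightarrow>
     ('a \<Rightarrow> 'e \<Rightarrow> 'e \<Rightarrow> real) \<Rightarrow> (complex ^ 'n \<Rightarrow> 'a \<Rightarrow> 'a) \<Rightarrow> ('a \<Rightarrow> (real ^ 'n) \<Rightarrow>\<^sub>L real) \<Rightarrow> bool" where
  "compact_toric_symplectic_manifold A \<Omega> act \<mu> \<longleftrightarrow>
     smooth_atlas A \<and> DIM('e) = 2 * CARD('n) \<and>
     compact (UNIV :: 'a set) \<and> connected (UNIV :: 'a set) \<and>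
     symplectic_form A \<Omega> \<and>
     hamiltonian_torus_action A \<Omega> act \<mu> \<and> effective_torus_action act"

definition lie_basis :: "('n \<Rightarrow> real ^ 'n) \<Rightarrow> bool" where
  "lie_basis e \<longleftrightarrow> inj e \<and> independent (range e) \<and> span (range e) = UNIV"

definition moment_polytope :: "('a \<Rightarrow> (real ^ 'n) \<Rightarrow>\<^sub>L real) \<Rightarrow> ((real ^ 'n) \<Rightarrow>\<^sub>L real) set" where
  "moment_polytope \<mu> = range \<mu>"

definition open_part :: "('a \<Rightarrow> (real ^ 'n) \<Rightarrow>\<^sub>L real) \<Rightarrow> 'a set" where
  "open_part \<mu> = \<mu> -` interior (moment_polytope \<mu>)"

definition moment_coords ::
  "('a \<Rightarrow> (real ^ 'n) \<Rightarrow>\<^sub>L real) \<Rightarrow> ('n \<Rightarrow> real ^ 'n) \<Rightarrow> 'a \<Rightarrow> real ^ 'n" where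
  "moment_coords \<mu> e p = (\<chi> j. blinfun_apply (\<mu> p) (e j))"

section \<open>Generalized Kaehler structures of symplectic type\<close>

text \<open>
  \<open>sharp B\<close> is the inverse of the map \<open>w \<mapsto> \<iota>\<^sub>w B\<close> from vectors to covectors, for a nondegenerate
  bilinear form \<open>B\<close>.
\<close>

definition sharp :: "('e \<Rightarrow> 'e \<Rightarrow> real) \<Rightarrow> ('e \<Rightarrow> real) \<Rightarrow> 'e" where
  "sharp B \<alpha> = (THE w. \<forall>v. B w v = \<alpha> v)"

definition J_minus ::
  "('a \<Rightarrow> 'e \<Rightarrow> 'e \<Rightarrow> real) \<Rightarrow> ('a \<Rightarrow> 'e \<Rightarrow> 'e) \<Rightarrow> 'a \<Rightarrow> 'e \<Rightarrow> 'e::euclidean_space" where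
  "J_minus \<Omega> Jp p u = - sharp (\<Omega> p) (\<lambda>v. \<Omega> p u (Jp p v))"

definition gk_metric ::
  "('a \<Rightarrow> 'e \<Rightarrow> 'e \<Rightarrow> real) \<Rightarrow> ('a \<Rightarrow> 'e \<Rightarrow> 'e) \<Rightarrow> 'a \<Rightarrow> 'e::euclidean_space \<Rightarrow> 'e \<Rightarrow> real" where
  "gk_metric \<Omega> Jp p u v = - (1/2) * \<Omega> p (Jp p u + J_minus \<Omega> Jp p u) v"

definition gk_bform ::
  "('a \<Rightarrow> 'e \<Rightarrow> 'e \<Rightarrow> real) \<Rightarrow> ('a \<Rightarrow> 'e \<Rightarrow> 'e) \<Rightarrow> 'a \<Rightarrow> 'e::euclidean_space \<Rightarrow> 'e \<Rightarrow> real" where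
  "gk_bform \<Omega> Jp p u v = - (1/2) * \<Omega> p (Jp p u - J_minus \<Omega> Jp p u) v"

definition GK ::
  "('a, 'e::euclidean_space) chart set \<Rightarrow> ('a \<Rightarrow> 'e \<Rightarrow> 'e \<Rightarrow> real) \<Rightarrow>
     (complex ^ 'n \<Rightarrow> 'a \<Rightarrow> 'a) \<Rightarrow> ('a \<Rightarrow> 'e \<Rightarrow> 'e) set" where
  "GK A \<Omega> act = {Jp.
     integrable_complex_structure A Jp \<and>
     (\<forall>t\<in>torus. \<forall>p v.
        tangent_map A (act t) p (Jp p v) = Jp (act t p) (tangent_map A (act t) p v)) \<and>
     (\<forall>p v. v \<noteq> 0 \<longrightarrow> \<Omega> p v (Jp p v) > 0) \<and>
     integrable_complex_structure A (J_minus \<Omega> Jp)}"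

definition orbit_distribution ::
  "('a, 'e::euclidean_space) chart set \<Rightarrow> (complex ^ 'n \<Rightarrow> 'a \<Rightarrow> 'a) \<Rightarrow> ('n \<Rightarrow> real ^ 'n) \<Rightarrow>
     'a \<Rightarrow> 'e set" where
  "orbit_distribution A act e p = span (range (\<lambda>j. fund_vf A act (e j) p))"

definition DGK ::
  "('a, 'e::euclidean_space) chart set \<Rightarrow> ('a \<Rightarrow> 'e \<Rightarrow> 'e \<Rightarrow> real) \<Rightarrow>
     (complex ^ 'n \<Rightarrow> 'a \<Rightarrow> 'a) \<Rightarrow> ('a \<Rightarrow> (real ^ 'n) \<Rightarrow>\<^sub>L real) \<Rightarrow> ('n \<Rightarrow> real ^ 'n) \<Rightarrow>
     ('a \<Rightarrow> 'e \<Rightarrow> 'e) set" where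
  "DGK A \<Omega> act \<mu> e = {Jp \<in> GK A \<Omega> act. \<forall>p\<in>open_part \<mu>.
     Jp p ` orbit_distribution A act e p = J_minus \<Omega> Jp p ` orbit_distribution A act e p}"

section \<open>Admissible coordinates and the averaged structure\<close>

text \<open>
  The functions \<open>\<theta>\<^sub>j\<close> are only locally defined, so admissible coordinates on the open part are given by
  local branches \<open>(U, \<theta>)\<close> whose domains cover the open part. The conditions on \<open>d\<theta>\<^sub>j\<close> say that it is the
  \<open>j\<close>-th element of the first half of the coframe dual to \<open>{X\<^sub>j, J\<^sub>+X\<^sub>j}\<close>.
\<close>

definition admissible_branch ::
  "('a::{t2_space,second_countable_topology}, 'e::euclidean_space) chart set \<Rightarrow>
     (complex ^ 'n \<Rightarrow> 'a \<Rightarrow> 'a) \<Rightarrow> ('a \<Rightarrow> (real ^ 'n) \<Rightarrow>\<^sub>L real) \<Rightarrow> ('n \<Rightarrow> real ^ 'n) \<Rightarrow>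
     ('a \<Rightarrow> 'e \<Rightarrow> 'e) \<Rightarrow> 'a set \<Rightarrow> ('a \<Rightarrow> real ^ 'n) \<Rightarrow> bool" where
  "admissible_branch A act \<mu> e Jp U \<theta> \<longleftrightarrow>
     local_coordinates A U (\<lambda>q. (\<theta> q, moment_coords \<mu> e q)) \<and>
     (\<forall>p\<in>U. \<forall>j k.
        mderiv A (\<lambda>q. \<theta> q $ j) p (fund_vf A act (e k) p) = (if j = k then 1 else 0) \<and>
        mderiv A (\<lambda>q. \<theta> q $ j) p (Jp p (fund_vf A act (e k) p)) = 0)"

definition admissible_coordinates ::
  "('a::{t2_space,second_countable_topology}, 'e::euclidean_space) chart set \<Rightarrow>
     (complex ^ 'n \<Rightarrow> 'a \<Rightarrow> 'a) \<Rightarrow> ('a \<Rightarrow> (real ^ 'n) \<Rightarrow>\<^sub>L real) \<Rightarrow> ('n \<Rightarrow> real ^ 'n) \<Rightarrow>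
     ('a \<Rightarrow> 'e \<Rightarrow> 'e) \<Rightarrow> ('a set \<times> ('a \<Rightarrow> real ^ 'n)) set \<Rightarrow> bool" where
  "admissible_coordinates A act \<mu> e Jp C \<longleftrightarrow>
     (\<Union>(U, \<theta>)\<in>C. U) = open_part \<mu> \<and>
     (\<forall>(U, \<theta>)\<in>C. admissible_branch A act \<mu> e Jp U \<theta>)"

text \<open>The coordinate vector fields of \<open>(\<theta>\<^sub>j, \<mu>\<^sub>j)\<close>.\<close>

definition d_theta ::
  "('a, 'e::euclidean_space) chart set \<Rightarrow> ('a \<Rightarrow> (real ^ 'n) \<Rightarrow>\<^sub>L real) \<Rightarrow> ('n \<Rightarrow> real ^ 'n) \<Rightarrow>
     ('a \<Rightarrow> real ^ 'n) \<Rightarrow> 'n \<Rightarrow> 'a \<Rightarrow> 'e" where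
  "d_theta A \<mu> e \<theta> k p = coord_vec A (\<lambda>q. (\<theta> q, moment_coords \<mu> e q)) p (axis k 1, 0)"

definition d_mu ::
  "('a, 'e::euclidean_space) chart set \<Rightarrow> ('a \<Rightarrow> (real ^ 'n) \<Rightarrow>\<^sub>L real) \<Rightarrow> ('n \<Rightarrow> real ^ 'n) \<Rightarrow>
     ('a \<Rightarrow> real ^ 'n) \<Rightarrow> 'n \<Rightarrow> 'a \<Rightarrow> 'e" where
  "d_mu A \<mu> e \<theta> k p = coord_vec A (\<lambda>q. (\<theta> q, moment_coords \<mu> e q)) p (0, axis k 1)"

definition phi ::
  "('a, 'e::euclidean_space) chart set \<Rightarrow> ('a \<Rightarrow> (real ^ 'n) \<Rightarrow>\<^sub>L real) \<Rightarrow> ('n \<Rightarrow> real ^ 'n) \<Rightarrow>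
     ('a \<Rightarrow> 'e \<Rightarrow> 'e) \<Rightarrow> ('a \<Rightarrow> real ^ 'n) \<Rightarrow> 'a \<Rightarrow> real ^ 'n ^ 'n" where
  "phi A \<mu> e Jp \<theta> p = (THE m. \<forall>k.
     Jp p (d_mu A \<mu> e \<theta> k p) = (\<Sum>j\<in>UNIV. m $ k $ j *\<^sub>R d_theta A \<mu> e \<theta> j p))"

definition phi_s ::
  "('a, 'e::euclidean_space) chart set \<Rightarrow> ('a \<Rightarrow> (real ^ 'n) \<Rightarrow>\<^sub>L real) \<Rightarrow> ('n \<Rightarrow> real ^ 'n) \<Rightarrow>
     ('a \<Rightarrow> 'e \<Rightarrow> 'e) \<Rightarrow> ('a \<Rightarrow> real ^ 'n) \<Rightarrow> 'a \<Rightarrow> real ^ 'n ^ 'n" where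
  "phi_s A \<mu> e Jp \<theta> p = (1/2) *\<^sub>R (phi A \<mu> e Jp \<theta> p + transpose (phi A \<mu> e Jp \<theta> p))"

definition averaged_structure ::
  "('a, 'e::euclidean_space) chart set \<Rightarrow> ('a \<Rightarrow> (real ^ 'n) \<Rightarrow>\<^sub>L real) \<Rightarrow> ('n \<Rightarrow> real ^ 'n) \<Rightarrow>
     ('a \<Rightarrow> 'e \<Rightarrow> 'e) \<Rightarrow> ('a set \<times> ('a \<Rightarrow> real ^ 'n)) set \<Rightarrow> 'a \<Rightarrow> 'e \<Rightarrow> 'e" where
  "averaged_structure A \<mu> e Jp C p = (THE J. linear J \<and>
     (\<forall>(U, \<theta>)\<in>C. p \<in> U \<longrightarrow> (\<forall>k.
        J (d_theta A \<mu> e \<theta> k p) =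
          - (\<Sum>j\<in>UNIV. matrix_inv (phi_s A \<mu> e Jp \<theta> p) $ k $ j *\<^sub>R d_mu A \<mu> e \<theta> j p) \<and>
        J (d_mu A \<mu> e \<theta> k p) =
          (\<Sum>j\<in>UNIV. phi_s A \<mu> e Jp \<theta> p $ k $ j *\<^sub>R d_theta A \<mu> e \<theta> j p))))"

section \<open>The generalized complexified torus action\<close>

definition X_plus ::
  "('a, 'e::euclidean_space) chart set \<Rightarrow> ('a \<Rightarrow> 'e \<Rightarrow> 'e \<Rightarrow> real) \<Rightarrow>
     (complex ^ 'n \<Rightarrow> 'a \<Rightarrow> 'a) \<Rightarrow> ('n \<Rightarrow> real ^ 'n) \<Rightarrow> ('a \<Rightarrow> 'e \<Rightarrow> 'e) \<Rightarrow> 'n \<Rightarrow> 'a \<Rightarrow> 'e" where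
  "X_plus A \<Omega> act e Jp j p = fund_vf A act (e j) p -
     sharp (gk_metric \<Omega> Jp p) (gk_bform \<Omega> Jp p (fund_vf A act (e j) p))"

definition Y_field ::
  "('a, 'e::euclidean_space) chart set \<Rightarrow> ('a \<Rightarrow> 'e \<Rightarrow> 'e \<Rightarrow> real) \<Rightarrow>
     (complex ^ 'n \<Rightarrow> 'a \<Rightarrow> 'a) \<Rightarrow> ('n \<Rightarrow> real ^ 'n) \<Rightarrow> ('a \<Rightarrow> 'e \<Rightarrow> 'e) \<Rightarrow> 'n \<Rightarrow> 'a \<Rightarrow> 'e" where
  "Y_field A \<Omega> act e Jp j p = Jp p (X_plus A \<Omega> act e Jp j p)"

definition complexified_action_structure ::
  "('a, 'e::euclidean_space) chart set \<Rightarrow> ('a \<Rightarrow> 'e \<Rightarrow> 'e \<Rightarrow> real) \<Rightarrow>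
     (complex ^ 'n \<Rightarrow> 'a \<Rightarrow> 'a) \<Rightarrow> ('n \<Rightarrow> real ^ 'n) \<Rightarrow> ('a \<Rightarrow> 'e \<Rightarrow> 'e) \<Rightarrow> 'a \<Rightarrow> 'e \<Rightarrow> 'e" where
  "complexified_action_structure A \<Omega> act e Jp p = (THE J. linear J \<and> (\<forall>j.
     J (fund_vf A act (e j) p) = Y_field A \<Omega> act e Jp j p \<and>
     J (Y_field A \<Omega> act e Jp j p) = - fund_vf A act (e j) p))"

definition inner_product_form :: "('e::euclidean_space \<Rightarrow> 'e \<Rightarrow> real) \<Rightarrow> bool" where
  "inner_product_form G \<longleftrightarrow>
     bilinear G \<and> (\<forall>u v. G u v = G v u) \<and> (\<forall>v. v \<noteq> 0 \<longrightarrow> G v v > 0)"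

definition tilde_metric ::
  "('a, 'e::euclidean_space) chart set \<Rightarrow> ('a \<Rightarrow> 'e \<Rightarrow> 'e \<Rightarrow> real) \<Rightarrow>
     (complex ^ 'n \<Rightarrow> 'a \<Rightarrow> 'a) \<Rightarrow> ('n \<Rightarrow> real ^ 'n) \<Rightarrow> ('a \<Rightarrow> 'e \<Rightarrow> 'e) \<Rightarrow>
     'a \<Rightarrow> 'e \<Rightarrow> 'e \<Rightarrow> real" where
  "tilde_metric A \<Omega> act e Jp p = (THE G. inner_product_form G \<and> (\<forall>j k.
     G (fund_vf A act (e j) p) (fund_vf A act (e k) p) =
       gk_metric \<Omega> Jp p (X_plus A \<Omega> act e Jp j p) (X_plus A \<Omega> act e Jp k p) \<and>
     G (Y_field A \<Omega> act e Jp j p) (Y_field A \<Omega> act e Jp k p) =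
       gk_metric \<Omega> Jp p (X_plus A \<Omega> act e Jp j p) (X_plus A \<Omega> act e Jp k p) \<and>
     G (fund_vf A act (e j) p) (Y_field A \<Omega> act e Jp k p) =
       gk_metric \<Omega> Jp p (fund_vf A act (e j) p) (Y_field A \<Omega> act e Jp k p)))"

definition kaehler_form ::
  "('a, 'e::euclidean_space) chart set \<Rightarrow> ('a \<Rightarrow> 'e \<Rightarrow> 'e \<Rightarrow> real) \<Rightarrow>
     (complex ^ 'n \<Rightarrow> 'a \<Rightarrow> 'a) \<Rightarrow> ('n \<Rightarrow> real ^ 'n) \<Rightarrow> ('a \<Rightarrow> 'e \<Rightarrow> 'e) \<Rightarrow>
     'a \<Rightarrow> 'e \<Rightarrow> 'e \<Rightarrow> real" where
  "kaehler_form A \<Omega> act e Jp p u v =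
     tilde_metric A \<Omega> act e Jp p (complexified_action_structure A \<Omega> act e Jp p u) v"

end

theory Submission
  imports Defs
begin

text \<open>
  The statement is linear algebra in each tangent space over the open part. Write \<open>\<omega> = \<Omega>\<^sub>p\<close>,
  \<open>J = J\<^sub>+\<close>, \<open>J' = J\<^sub>-\<close>, \<open>D = span {X\<^sub>j}\<close> and \<open>N = J D = J' D\<close>.

  \<^bold>\<open>The fields\<close> \<open>Y\<^sub>j\<close>. By definition \<open>w = g\<^sup>-\<^sup>1 b(u)\<close> solves \<open>(J + J') w = (J - J') u\<close>. Subtracting this
  from \<open>(J + J') u\<close> gives \<open>(J + J') (u - w) = 2 J' u\<close>, and applying \<open>J'\<close> turns it into
  \<open>(J + J') J (u - w) = - 2 u\<close>. Hence \<open>Y\<^sub>j = L X\<^sub>j\<close> with \<open>L = - 2 (J + J')\<^sup>-\<^sup>1\<close>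
  (\<open>J_shift_eq_L\<close>); this inverse exists because \<open>g = - \<omega>(J + J')/2\<close> is positive definite by
  tameness.

  \<^bold>\<open>The Lagrangian splitting.\<close> The moment map is constant on orbits, so \<open>D\<close> is isotropic. As \<open>J'\<close> is
  minus the \<open>\<omega>\<close>-adjoint of \<open>J\<close>, also \<open>\<omega>(J' x, J y) = \<omega>(x, y)\<close> vanishes on \<open>D\<close>; since \<open>N\<close> is both \<open>J D\<close>
  and \<open>J' D\<close>, it is isotropic too. The differentials \<open>d\<theta>\<^sub>j\<close> vanish on \<open>J D\<close>, so in admissible
  coordinates \<open>D\<close> is spanned by the \<open>\<partial>\<^sub>\<theta>\<close> and \<open>N\<close> by the \<open>\<partial>\<^sub>\<mu>\<close>. Both \<open>J\<close> and \<open>J'\<close> exchange \<open>D\<close> and \<open>N\<close>, so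
  \<open>L\<close> maps \<open>D\<close> onto \<open>N\<close>.

  \<^bold>\<open>Comparison.\<close> The structure \<open>J\<^sub>0\<close> is \<open>L\<close> on \<open>D\<close>, and from \<open>J\<^sub>0 Y\<^sub>j = - X\<^sub>j\<close> it is \<open>(J + J')/2\<close> on \<open>N\<close>. The
  adjoint relation says that the matrix of \<open>J'\<close> from \<open>\<partial>\<^sub>\<mu>\<close> to \<open>\<partial>\<^sub>\<theta>\<close> is the transpose of that of \<open>J\<close>, so
  \<open>(J + J')/2\<close> has matrix \<open>\<phi>\<^sub>s\<close>, and its negative inverse \<open>L\<close> on \<open>D\<close> has matrix \<open>- \<phi>\<^sub>s\<^sup>-\<^sup>1\<close>
  (\<open>J0_M\<close>, \<open>J0_X\<close>). This is the averaged structure.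

  \<^bold>\<open>The Kaehler form.\<close> The form \<open>G(u, v) = - \<omega>(J\<^sub>0 u, v)\<close> satisfies \<open>G(J\<^sub>0 u, v) = \<omega>(u, v)\<close> because
  \<open>J\<^sub>0\<^sup>2 = - 1\<close>. It has the prescribed values on the frame \<open>{X\<^sub>j, Y\<^sub>j}\<close>: the mixed ones vanish by
  isotropy, the others are \<open>\<omega>(X\<^sub>j, Y\<^sub>k) = g(Y\<^sub>j, Y\<^sub>k) = g(X\<^sub>j\<^sup>+, X\<^sub>k\<^sup>+)\<close>, as \<open>g\<close> is \<open>J\<close>-invariant. Therefore
  \<open>G\<close> is the metric \<open>g~\<close> (\<open>frame_metric_eq_G\<close>).
\<close>

section \<open>Linear algebra of bilinear forms and matrices\<close>

text \<open>
  On a finite-dimensional space a form with trivial left kernel identifies vectors with covectors, so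
  the definite description in \<^const>\<open>sharp\<close> denotes the vector that it describes.
\<close>

lemma sharp_works:
  fixes B :: "'e::euclidean_space \<Rightarrow> 'e \<Rightarrow> real"
  assumes B: "bilinear B" and nondeg: "\<And>u. (\<And>v. B u v = 0) \<Longrightarrow> u = 0" and \<alpha>: "linear \<alpha>"
  shows "B (sharp B \<alpha>) v = \<alpha> v"
proof -
  \<comment> \<open>\<open>T u\<close> represents the covector \<open>B u\<close> with respect to the Euclidean inner product\<close>
  define T where "T u = (\<Sum>b\<in>Basis. B u b *\<^sub>R b)" for u
  have lin: "linear (\<lambda>u. B u v)" "linear (B v)" for v
    using B by (auto simp: bilinear_def)
  have "linear T"
    unfolding T_def
    by (intro linearI)
      (simp_all add: linear_add[OF lin(1)] linear_scale[OF lin(1)] scaleR_add_left sum.distrib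
        scaleR_sum_right)
  have T: "T u \<bullet> v = B u v" for u v
  proof -
    have "T u \<bullet> v = (\<Sum>b\<in>Basis. (v \<bullet> b) * B u b)"
      unfolding T_def inner_sum_left inner_scaleR_left
      by (intro sum.cong refl) (simp add: inner_commute)
    also have "\<dots> = B u (\<Sum>b\<in>Basis. (v \<bullet> b) *\<^sub>R b)"
      by (simp add: linear_sum[OF lin(2)] linear_scale[OF lin(2)])
    finally show ?thesis by (simp add: euclidean_representation)
  qed
  have "inj T"
    unfolding linear_injective_0[OF \<open>linear T\<close>]
  proof (intro allI impI nondeg)
    fix u v assume "T u = 0"
    then show "B u v = 0" by (simp flip: T)
  qed
  then have "surj T"
    by (rule linear_injective_imp_surjective[OF \<open>linear T\<close>]) simp
  then obtain w where w: "T w = (\<Sum>b\<in>Basis. \<alpha> b *\<^sub>R b)" by (metis surjD)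
  have "B w v = \<alpha> v" for v
  proof -
    have "B w v = (\<Sum>b\<in>Basis. (v \<bullet> b) * \<alpha> b)"
      unfolding T[symmetric] w inner_sum_left inner_scaleR_left
      by (intro sum.cong refl) (simp add: inner_commute)
    also have "\<dots> = \<alpha> (\<Sum>b\<in>Basis. (v \<bullet> b) *\<^sub>R b)"
      by (simp add: linear_sum[OF \<alpha>] linear_scale[OF \<alpha>])
    finally show ?thesis by (simp add: euclidean_representation)
  qed
  moreover have "w' = w" if "\<forall>v. B w' v = \<alpha> v" for w'
  proof -
    have "B (w' - w) v = 0" for v
      using that \<open>\<And>v. B w v = \<alpha> v\<close> by (simp add: linear_diff[OF lin(1)])
    then have "w' - w = 0" by (rule nondeg)
    then show ?thesis by simp
  qed
  ultimately have "\<forall>v. B (sharp B \<alpha>) v = \<alpha> v"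
    unfolding sharp_def by (intro theI[of "\<lambda>w. \<forall>v. B w v = \<alpha> v" w]) auto
  then show ?thesis by blast
qed

lemma matrix_inv_eqI:
  fixes A B :: "real ^ 'n ^ 'n"
  assumes "B ** A = mat 1"
  shows "matrix_inv A = B"
proof -
  have AB: "A ** B = mat 1" using assms matrix_left_right_inverse by blast
  then have "A ** matrix_inv A = mat 1 \<and> matrix_inv A ** A = mat 1"
    unfolding matrix_inv_def by (intro someI_ex[of "\<lambda>A'. A ** A' = mat 1 \<and> A' ** A = mat 1"]) (use assms in blast)
  then have "B ** (A ** matrix_inv A) = B" by simp
  then show ?thesis by (simp add: matrix_mul_assoc assms)
qed

section \<open>Linear algebra on a tangent space of the open part\<close>

text \<open>
  The data on one tangent space: \<open>\<omega>\<close>, \<open>J\<close> and \<open>J'\<close> are the values of \<open>\<Omega>\<close>, \<open>J\<^sub>+\<close> and \<open>J\<^sub>-\<close>, and \<open>X\<close> lists the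
  fundamental fields. The map \<open>\<Phi>\<close> is the differential \<open>(d\<theta>, d\<mu>)\<close> of admissible coordinates, so that
  \<open>inv \<Phi>\<close> of a basis vector is a coordinate vector. The assumption \<open>moment\<close> is the moment map equation,
  and the second component of \<open>\<Phi>_X\<close> expresses invariance of the moment map.
\<close>

locale tamed_toric_frame =
  fixes \<omega> :: "'e::euclidean_space \<Rightarrow> 'e \<Rightarrow> real"
    and J J' :: "'e \<Rightarrow> 'e"
    and X :: "'n::finite \<Rightarrow> 'e"
    and \<Phi> :: "'e \<Rightarrow> (real ^ 'n) \<times> (real ^ 'n)"
  assumes bilinear: "bilinear \<omega>"
    and skew: "\<omega> u v = - \<omega> v u"
    and linear_J: "linear J"
    and J_J: "J (J v) = - v"
    and tamed: "v \<noteq> 0 \<Longrightarrow> \<omega> v (J v) > 0"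
    and adjoint: "\<omega> (J' u) v = - \<omega> u (J v)"
    and linear_\<Phi>: "linear \<Phi>"
    and bij_\<Phi>: "bij \<Phi>"
    and \<Phi>_X: "\<Phi> (X k) = (axis k 1, 0)"
    and \<Phi>_J_X: "fst (\<Phi> (J (X k))) = 0"
    and moment: "snd (\<Phi> v) $ j = - \<omega> (X j) v"
    and J_span: "J ` span (range X) = J' ` span (range X)"
begin

abbreviation "D \<equiv> span (range X)"
abbreviation "N \<equiv> {v. fst (\<Phi> v) = 0}"
abbreviation "g u v \<equiv> - (1/2) * \<omega> (J u + J' u) v"

lemmas \<omega>_simps = bilinear_ladd[OF bilinear] bilinear_radd[OF bilinear]
  bilinear_lmul[OF bilinear] bilinear_rmul[OF bilinear] bilinear_lneg[OF bilinear]
  bilinear_rneg[OF bilinear] bilinear_lsub[OF bilinear] bilinear_rsub[OF bilinear]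
  bilinear_lzero[OF bilinear] bilinear_rzero[OF bilinear]
lemmas \<Phi>_simps = linear_add[OF linear_\<Phi>] linear_scale[OF linear_\<Phi>] linear_neg[OF linear_\<Phi>]
  linear_diff[OF linear_\<Phi>] linear_0[OF linear_\<Phi>]
lemmas J_simps = linear_add[OF linear_J] linear_scale[OF linear_J] linear_neg[OF linear_J]
  linear_diff[OF linear_J] linear_0[OF linear_J]

lemma nondegenerate:
  assumes "\<And>v. \<omega> u v = \<omega> w v"
  shows "u = w"
proof (rule ccontr)
  assume "u \<noteq> w"
  then have "\<omega> (u - w) (J (u - w)) > 0" by (intro tamed) simp
  with assms show False by (simp add: \<omega>_simps)
qed

text \<open>
  Linearity and the square of \<open>J'\<close> are read off from \<open>J\<close> through the adjoint relation.
\<close>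

lemma linear_J': "linear J'"
  by (rule linearI; rule nondegenerate) (simp_all add: adjoint \<omega>_simps)

lemmas J'_simps = linear_add[OF linear_J'] linear_scale[OF linear_J'] linear_neg[OF linear_J']
  linear_diff[OF linear_J'] linear_0[OF linear_J']

lemma J'_J': "J' (J' v) = - v"
  by (rule nondegenerate) (simp add: adjoint J_J \<omega>_simps)

text \<open>
  The part of \<open>- \<omega>(J + J')/2\<close> coming from \<open>J'\<close> is the transpose of the part coming from \<open>J\<close>.
\<close>

lemma g_symmetric: "g u v = g v u"
  using adjoint[of u v] adjoint[of v u] skew[of u "J v"] skew[of v "J u"]
  by (simp add: \<omega>_simps)

lemma g_diagonal: "g v v = \<omega> v (J v)"
  using adjoint[of v v] skew[of "J v" v] by (simp add: \<omega>_simps)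

lemma linear_sum_J: "linear (\<lambda>v. J v + J' v)"
  by (intro linear_compose_add linear_J linear_J')

lemma sum_J_eq_0: "J v + J' v = 0 \<Longrightarrow> v = 0"
  using g_diagonal[of v] tamed[of v] by (auto simp: \<omega>_simps)

lemma inj_sum_J: "inj (\<lambda>v. J v + J' v)"
  unfolding linear_injective_0[OF linear_sum_J] by (blast intro: sum_J_eq_0)

lemma sum_J_cancel: "J u + J' u = J v + J' v \<longleftrightarrow> u = v"
  by (rule inj_eq[OF inj_sum_J])

text \<open>
  The inverse of \<open>- (J + J')/2\<close>, which is bijective because \<open>g\<close> is definite.
\<close>

definition L :: "'e \<Rightarrow> 'e" where
  "L u = (SOME y. J y + J' y = - 2 *\<^sub>R u)"

lemma sum_J_L: "J (L u) + J' (L u) = - 2 *\<^sub>R u"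
proof -
  have "surj (\<lambda>v. J v + J' v)"
    by (rule linear_injective_imp_surjective[OF linear_sum_J inj_sum_J]) simp
  from surjD[OF this, of "- 2 *\<^sub>R u"] have "\<exists>y. J y + J' y = - 2 *\<^sub>R u"
    by (auto simp only: eq_commute)
  then show ?thesis unfolding L_def by (rule someI_ex)
qed

lemma L_eqI: "J y + J' y = - 2 *\<^sub>R u \<Longrightarrow> L u = y"
  using sum_J_L[of u] sum_J_cancel[of "L u" y] by simp

lemma linear_L: "linear L"
proof (rule linearI)
  fix u v c
  have "J (L u + L v) + J' (L u + L v) = (J (L u) + J' (L u)) + (J (L v) + J' (L v))"
    by (simp add: J_simps J'_simps)
  then show "L (u + v) = L u + L v"
    by (intro L_eqI) (simp only: sum_J_L scaleR_add_right)
  have "J (c *\<^sub>R L u) + J' (c *\<^sub>R L u) = c *\<^sub>R (J (L u) + J' (L u))"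
    by (simp add: J_simps J'_simps scaleR_add_right)
  then show "L (c *\<^sub>R u) = c *\<^sub>R L u"
    by (intro L_eqI) (simp only: sum_J_L scaleR_left_commute)
qed

lemmas L_simps = linear_add[OF linear_L] linear_scale[OF linear_L] linear_neg[OF linear_L]
  linear_diff[OF linear_L] linear_0[OF linear_L]

text \<open>
  Here \<open>w\<close> is \<open>g\<^sup>-\<^sup>1 b(u)\<close>. Its equation is \<open>J' w = J u - J' u - J w\<close>, and applying \<open>J'\<close> to this one produces
  the defining equation of \<open>L u\<close> for \<open>J (u - w)\<close>.
\<close>

lemma J_shift_eq_L:
  assumes w: "\<And>v. g w v = - (1/2) * \<omega> (J u - J' u) v"
  shows "J (u - w) = L u"
proof -
  have "J w + J' w = J u - J' u"
    using w by (intro nondegenerate) simp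
  then have *: "J' w = J u - J' u - J w" by (simp add: algebra_simps)
  have "J' (J' w) = J' (J u) - J' (J' u) - J' (J w)"
    unfolding * by (simp add: J'_simps)
  then have "J' (J (u - w)) = - u - w"
    by (simp add: J'_J' J_simps J'_simps algebra_simps)
  then have "J (J (u - w)) + J' (J (u - w)) = - 2 *\<^sub>R u"
    by (simp add: J_J scaleR_2)
  then show ?thesis by (rule L_eqI[symmetric])
qed

lemma J_sharp_shift_eq_L: "J (u - sharp g (\<lambda>v. - (1/2) * \<omega> (J u - J' u) v)) = L u"
proof (rule J_shift_eq_L)
  have bil: "bilinear g"
    unfolding bilinear_def by (auto intro!: linearI simp: J_simps J'_simps \<omega>_simps algebra_simps add_divide_distrib)
  have lin: "linear (\<lambda>v. - (1/2) * \<omega> (J u - J' u) v)"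
    by (auto intro!: linearI simp: \<omega>_simps algebra_simps add_divide_distrib diff_divide_distrib)
  have nondeg: "w = 0" if "\<And>v. g w v = 0" for w
    using that[of w] tamed[of w] unfolding g_diagonal by fastforce
  show "g (sharp g (\<lambda>v. - (1/2) * \<omega> (J u - J' u) v)) v = - (1/2) * \<omega> (J u - J' u) v" for v
    by (rule sharp_works[OF bil nondeg lin])
qed

lemma inv_\<Phi> [simp]: "inv \<Phi> (\<Phi> v) = v" "\<Phi> (inv \<Phi> z) = z"
  using bij_\<Phi> by (simp_all add: bij_is_inj bij_is_surj surj_f_inv_f)

lemma linear_inv_\<Phi>: "linear (inv \<Phi>)"
  by (rule linearI; rule injD[OF bij_is_inj[OF bij_\<Phi>]]) (simp_all add: \<Phi>_simps)

lemma \<Phi>_eqD: "\<Phi> u = \<Phi> v \<Longrightarrow> u = v"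
  by (rule injD[OF bij_is_inj[OF bij_\<Phi>]])

lemma \<Phi>_combination: "\<Phi> (\<Sum>k\<in>UNIV. c k *\<^sub>R X k) = (\<chi> k. c k, 0)"
proof -
  have "\<Phi> (\<Sum>k\<in>UNIV. c k *\<^sub>R X k) = (\<Sum>k\<in>UNIV. (c k *\<^sub>R axis k 1, 0))"
    by (simp add: linear_sum[OF linear_\<Phi>] \<Phi>_simps \<Phi>_X)
  also have "\<dots> = (\<chi> k. c k, 0)"
    by (simp add: sum_prod vec_eq_iff axis_def sum_component if_distrib cong: if_cong)
  finally show ?thesis .
qed

text \<open>
  In admissible coordinates the orbit directions are spanned by the \<open>\<partial>\<^sub>\<theta>\<close>.
\<close>

lemma D_eq: "D = {v. snd (\<Phi> v) = 0}"
proof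
  show "D \<subseteq> {v. snd (\<Phi> v) = 0}"
    by (rule span_minimal) (auto simp: \<Phi>_X subspace_def \<Phi>_simps)
  show "{v. snd (\<Phi> v) = 0} \<subseteq> D"
  proof
    fix v assume "v \<in> {v. snd (\<Phi> v) = 0}"
    then have "\<Phi> v = \<Phi> (\<Sum>k\<in>UNIV. (fst (\<Phi> v) $ k) *\<^sub>R X k)"
      by (simp add: \<Phi>_combination prod_eq_iff)
    then have "v = (\<Sum>k\<in>UNIV. (fst (\<Phi> v) $ k) *\<^sub>R X k)" by (rule \<Phi>_eqD)
    then show "v \<in> D" by (metis (no_types, lifting) span_sum span_scale span_base rangeI)
  qed
qed

text \<open>
  The differentials \<open>d\<theta>\<^sub>j\<close> kill \<open>J D\<close>, which gives one inclusion; the other holds because both spaces are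
  \<open>n\<close>-dimensional. The dimension count is made through the endomorphism of \<open>\<real>\<^sup>n\<close> that \<open>J\<close> induces in
  coordinates: it is injective, hence surjective.
\<close>

lemma J_D: "J ` D = N"
proof -
  have sub: "J x \<in> N" if "x \<in> D" for x
  proof -
    have "D \<subseteq> {x. J x \<in> N}"
      by (rule span_minimal) (auto simp: subspace_def \<Phi>_J_X J_simps \<Phi>_simps)
    with that show ?thesis by blast
  qed
  define f where "f a = snd (\<Phi> (J (inv \<Phi> (a, 0))))" for a
  have lin: "linear f"
  proof -
    have "linear (snd \<circ> \<Phi> \<circ> J \<circ> inv \<Phi> \<circ> (\<lambda>a. (a, 0)))"
      by (intro linear_compose linear_J linear_\<Phi> linear_inv_\<Phi> module_hom_snd linearI) auto
    then show ?thesis by (simp add: f_def[abs_def] o_def)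
  qed
  have "inj f"
    unfolding linear_injective_0[OF lin]
  proof safe
    fix a assume a: "f a = 0"
    have "inv \<Phi> (a, 0) \<in> D" by (simp add: D_eq)
    then have "\<Phi> (J (inv \<Phi> (a, 0))) = \<Phi> 0"
      using sub a by (auto simp: f_def prod_eq_iff \<Phi>_simps)
    then have "J (inv \<Phi> (a, 0)) = 0" by (rule \<Phi>_eqD)
    then have "inv \<Phi> (a, 0) = 0" by (metis J_J J_simps(5) neg_equal_0_iff_equal)
    then have "(a, 0) = \<Phi> 0" by (metis inv_\<Phi>(2))
    then show "a = 0" by (simp add: \<Phi>_simps prod_eq_iff)
  qed
  then have "surj f" by (rule linear_injective_imp_surjective[OF lin]) simp
  show ?thesis
  proof
    show "J ` D \<subseteq> N" using sub by blast
    show "N \<subseteq> J ` D"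
    proof
      fix y assume y: "y \<in> N"
      obtain a where a: "snd (\<Phi> y) = f a" using \<open>surj f\<close> by (metis surjD)
      have D: "inv \<Phi> (a, 0) \<in> D" by (simp add: D_eq)
      have "\<Phi> y = \<Phi> (J (inv \<Phi> (a, 0)))"
        using y a sub[OF D] by (simp add: f_def prod_eq_iff)
      then show "y \<in> J ` D" using D \<Phi>_eqD by blast
    qed
  qed
qed

lemma D_isotropic: "u \<in> D \<Longrightarrow> v \<in> D \<Longrightarrow> \<omega> u v = 0"
proof -
  assume u: "u \<in> D" and v: "v \<in> D"
  have "D \<subseteq> {u. \<omega> u v = 0}"
  proof (rule span_minimal)
    have "\<omega> (X j) v = 0" for j
      using v moment[of v j] by (simp add: D_eq)
    then show "range X \<subseteq> {u. \<omega> u v = 0}" by auto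
    show "subspace {u. \<omega> u v = 0}" by (auto simp: subspace_def \<omega>_simps)
  qed
  with u show ?thesis by blast
qed

text \<open>
  As \<open>N\<close> is both \<open>J D\<close> and \<open>J' D\<close>, one argument can be written as \<open>J' x\<close> and the other
  as \<open>J y\<close> with \<open>x\<close> and \<open>y\<close> in \<open>D\<close>; then \<open>\<omega>(J' x, J y) = \<omega>(x, y)\<close>.
\<close>

lemma N_isotropic:
  assumes "u \<in> N" "v \<in> N"
  shows "\<omega> u v = 0"
proof -
  obtain x where x: "x \<in> D" "u = J' x" using assms(1) J_D J_span by auto
  obtain y where y: "y \<in> D" "v = J y" using assms(2) J_D by auto
  show ?thesis
    using D_isotropic[OF x(1) y(1)] by (simp add: x(2) y(2) adjoint J_J \<omega>_simps)
qed

lemma J_N: "y \<in> N \<Longrightarrow> J y \<in> D"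
  and J'_N: "y \<in> N \<Longrightarrow> J' y \<in> D"
proof -
  assume y: "y \<in> N"
  from y obtain x where "x \<in> D" "y = J x" using J_D by auto
  then show "J y \<in> D" by (simp add: J_J span_neg)
  from y obtain x where "x \<in> D" "y = J' x" using J_D J_span by auto
  then show "J' y \<in> D" by (simp add: J'_J' span_neg)
qed

text \<open>
  As \<open>J + J'\<close> maps \<open>N\<close> injectively into \<open>D\<close>, the same dimension count as for \<open>J_D\<close> makes it onto, and \<open>L\<close>
  inverts it up to a factor.
\<close>

lemma L_D:
  assumes "x \<in> D"
  shows "L x \<in> N"
proof -
  define f where "f b = fst (\<Phi> (J (inv \<Phi> (0, b)) + J' (inv \<Phi> (0, b))))" for b
  have sub: "J (inv \<Phi> (0, b)) + J' (inv \<Phi> (0, b)) \<in> D" for b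
    by (intro span_add J_N J'_N) auto
  have lin: "linear f"
  proof -
    have "linear (fst \<circ> \<Phi> \<circ> (\<lambda>v. J v + J' v) \<circ> inv \<Phi> \<circ> (\<lambda>b. (0, b)))"
      by (intro linear_compose linear_sum_J linear_\<Phi> linear_inv_\<Phi> module_hom_fst linearI) auto
    then show ?thesis by (simp add: f_def[abs_def] o_def)
  qed
  have "inj f"
    unfolding linear_injective_0[OF lin]
  proof safe
    fix b assume b: "f b = 0"
    have "\<Phi> (J (inv \<Phi> (0, b)) + J' (inv \<Phi> (0, b))) = \<Phi> 0"
      using sub[of b] b unfolding D_eq by (simp add: f_def prod_eq_iff \<Phi>_simps(5))
    then have "inv \<Phi> (0, b) = 0" by (rule sum_J_eq_0[OF \<Phi>_eqD])
    then have "(0, b) = \<Phi> 0" by (metis inv_\<Phi>(2))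
    then show "b = 0" by (simp add: \<Phi>_simps prod_eq_iff)
  qed
  then have "surj f" by (rule linear_injective_imp_surjective[OF lin]) simp
  then obtain b where b: "fst (\<Phi> (- 2 *\<^sub>R x)) = f b" by (metis surjD)
  have "- 2 *\<^sub>R x \<in> D" using assms by (rule span_scale)
  then have "\<Phi> (J (inv \<Phi> (0, b)) + J' (inv \<Phi> (0, b))) = \<Phi> (- 2 *\<^sub>R x)"
    using sub[of b] b unfolding D_eq by (simp add: f_def prod_eq_iff)
  then have "L x = inv \<Phi> (0, b)" by (rule L_eqI[OF \<Phi>_eqD])
  then show ?thesis by simp
qed

lemma L_inverse: "L ((1/2) *\<^sub>R (J v + J' v)) = - v"
  by (rule L_eqI) (simp add: J_simps J'_simps)

lemma N_eq: "N = span (range (\<lambda>j. L (X j)))"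
proof -
  have "N = L ` D"
  proof
    show "N \<subseteq> L ` D"
    proof
      fix y assume "y \<in> N"
      then have "- (1/2) *\<^sub>R (J y + J' y) \<in> D" by (intro span_scale span_add J_N J'_N)
      moreover have "L (- (1/2) *\<^sub>R (J y + J' y)) = y"
        using L_inverse[of y] by (simp add: L_simps)
      ultimately show "y \<in> L ` D" by (metis image_eqI)
    qed
  qed (use L_D in auto)
  also have "\<dots> = span (range (\<lambda>j. L (X j)))"
    using linear_span_image[OF linear_L, of "range X"] by (simp add: image_image)
  finally show ?thesis .
qed

lemma decompose:
  obtains x y where "x \<in> D" "y \<in> N" "v = x + y"
proof
  show "inv \<Phi> (fst (\<Phi> v), 0) \<in> D" by (simp add: D_eq)
  show "inv \<Phi> (0, snd (\<Phi> v)) \<in> N" by simp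
  show "v = inv \<Phi> (fst (\<Phi> v), 0) + inv \<Phi> (0, snd (\<Phi> v))"
    by (rule \<Phi>_eqD) (simp add: \<Phi>_simps)
qed

lemma span_frame: "span (range X \<union> range (\<lambda>j. L (X j))) = UNIV"
proof -
  have "v \<in> span (range X \<union> range (\<lambda>j. L (X j)))" for v
  proof (rule decompose[of v])
    fix x y assume "x \<in> D" "y \<in> N" "v = x + y"
    moreover have "D \<subseteq> span (range X \<union> range (\<lambda>j. L (X j)))"
      by (intro span_mono) blast
    moreover have "N \<subseteq> span (range X \<union> range (\<lambda>j. L (X j)))"
      unfolding N_eq by (intro span_mono) blast
    ultimately show ?thesis by (blast intro: span_add)
  qed
  then show ?thesis by blast
qed

text \<open>
  The only linear map with \<open>X\<^sub>j \<mapsto> Y\<^sub>j\<close> and \<open>Y\<^sub>j \<mapsto> - X\<^sub>j\<close>, written out in the splitting into \<open>D\<close> and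
  \<open>N\<close>: since \<open>Y\<^sub>j = L X\<^sub>j\<close> and \<open>L\<close> inverts \<open>- (J + J')/2\<close>, it must be \<open>(J + J')/2\<close> on \<open>N\<close>.
\<close>

definition J0 :: "'e \<Rightarrow> 'e" where
  "J0 v = L (inv \<Phi> (fst (\<Phi> v), 0)) +
     (1/2) *\<^sub>R (J (inv \<Phi> (0, snd (\<Phi> v))) + J' (inv \<Phi> (0, snd (\<Phi> v))))"

lemma linear_J0: "linear J0"
proof -
  have "linear (L \<circ> inv \<Phi> \<circ> (\<lambda>z. (fst z, 0)) \<circ> \<Phi>)"
    by (intro linear_compose linear_\<Phi> linear_inv_\<Phi> linear_L linearI) auto
  moreover have "linear ((*\<^sub>R) (1/2) \<circ> (\<lambda>v. J v + J' v) \<circ> inv \<Phi> \<circ> (\<lambda>z. (0, snd z)) \<circ> \<Phi>)"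
    by (intro linear_compose linear_\<Phi> linear_inv_\<Phi> linear_sum_J linear_scale_self linearI)
      (auto simp: scaleR_add_right)
  ultimately show ?thesis
    unfolding J0_def[abs_def] using linear_compose_add by (fastforce simp: o_def)
qed

lemma J0_D:
  assumes "x \<in> D" shows "J0 x = L x"
proof -
  have "\<Phi> x = (fst (\<Phi> x), 0)" using assms by (simp add: D_eq prod_eq_iff)
  then have "inv \<Phi> (fst (\<Phi> x), 0) = x" by (metis inv_\<Phi>(1))
  moreover have "inv \<Phi> (0, snd (\<Phi> x)) = 0"
    using assms by (intro \<Phi>_eqD[of _ 0]) (simp add: D_eq \<Phi>_simps zero_prod_def)
  ultimately show ?thesis by (simp add: J0_def J_simps J'_simps)
qed

lemma J0_N:
  assumes "y \<in> N" shows "J0 y = (1/2) *\<^sub>R (J y + J' y)"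
proof -
  have "\<Phi> y = (0, snd (\<Phi> y))" using assms by (simp add: prod_eq_iff)
  then have "inv \<Phi> (0, snd (\<Phi> y)) = y" by (metis inv_\<Phi>(1))
  moreover have "inv \<Phi> (fst (\<Phi> y), 0) = 0"
    using assms by (intro \<Phi>_eqD[of _ 0]) (simp add: \<Phi>_simps zero_prod_def)
  ultimately show ?thesis by (simp add: J0_def L_simps)
qed

lemma J0_frame: "J0 (X j) = L (X j)" "J0 (L (X j)) = - X j"
proof -
  have X: "X j \<in> D" by (simp add: span_base)
  then show "J0 (X j) = L (X j)" by (rule J0_D)
  show "J0 (L (X j)) = - X j"
    unfolding J0_N[OF L_D[OF X]] by (simp add: sum_J_L)
qed

lemma J0_unique:
  assumes "linear F" "\<And>j. F (X j) = L (X j)" "\<And>j. F (L (X j)) = - X j"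
  shows "F = J0"
proof
  fix v
  show "F v = J0 v"
    by (rule linear_eq_on[OF assms(1) linear_J0, of v "range X \<union> range (\<lambda>j. L (X j))"])
      (use assms(2,3) in \<open>auto simp: span_frame J0_frame\<close>)
qed

lemma frame_structure_eq_J0:
  "(THE F. linear F \<and> (\<forall>j. F (X j) = L (X j) \<and> F (L (X j)) = - X j)) = J0"
proof (rule the_equality)
  show "linear J0 \<and> (\<forall>j. J0 (X j) = L (X j) \<and> J0 (L (X j)) = - X j)"
    using linear_J0 J0_frame by blast
qed (blast intro: J0_unique)

lemma J0_J0: "J0 (J0 v) = - v"
proof (rule decompose[of v])
  fix x y assume x: "x \<in> D" and y: "y \<in> N" and v: "v = x + y"
  have "J0 (J0 x) = - x"
    by (simp add: J0_D[OF x] J0_N[OF L_D[OF x]] sum_J_L)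
  moreover have "(1/2) *\<^sub>R (J y + J' y) \<in> D"
    by (intro span_scale span_add J_N J'_N y)
  then have "J0 (J0 y) = - y"
    by (simp add: J0_N[OF y] J0_D L_inverse)
  ultimately show ?thesis by (simp add: v linear_add[OF linear_J0])
qed

text \<open>
  Since \<open>(J + J') L = - 2\<close>, the metric \<open>g\<close> on the vectors \<open>Y\<^sub>j = L X\<^sub>j\<close> reduces to \<open>\<omega>\<close>.
\<close>

lemma gram: "g (L (X j)) (L (X k)) = \<omega> (X j) (L (X k))"
  by (simp only: sum_J_L) (simp add: \<omega>_simps)

lemma g_J: "g (J u) (J v) = g u v"
  using adjoint[of u v] adjoint[of "J u" "J v"] by (simp add: J_J \<omega>_simps)

lemma \<omega>_L_X_sym: "\<omega> (X j) (L (X k)) = \<omega> (X k) (L (X j))"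
  using gram[of j k] gram[of k j] g_symmetric[of "L (X j)" "L (X k)"] by simp

text \<open>
  The metric for which \<open>\<omega>\<close> becomes the fundamental form of \<open>J0\<close>.
\<close>

definition G :: "'e \<Rightarrow> 'e \<Rightarrow> real" where "G u v = - \<omega> (J0 u) v"

lemma bilinear_G: "bilinear G"
  unfolding bilinear_def G_def
  by (auto intro!: linearI simp: linear_add[OF linear_J0] linear_scale[OF linear_J0] \<omega>_simps)

lemma G_frame:
  "G (X j) (X k) = g (L (X j)) (L (X k))"
  "G (L (X j)) (L (X k)) = g (L (X j)) (L (X k))"
  "G (X j) (L (X k)) = 0" "G (L (X j)) (X k) = 0"
proof -
  have X: "X j \<in> D" for j by (simp add: span_base)
  show "G (X j) (X k) = g (L (X j)) (L (X k))"
    using skew[of "L (X j)" "X k"] \<omega>_L_X_sym[of j k]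
    unfolding gram by (simp add: G_def J0_frame)
  show "G (L (X j)) (L (X k)) = g (L (X j)) (L (X k))"
    unfolding gram by (simp add: G_def J0_frame \<omega>_simps)
  show "G (X j) (L (X k)) = 0"
    using N_isotropic[OF L_D[OF X] L_D[OF X]] by (simp add: G_def J0_frame)
  show "G (L (X j)) (X k) = 0"
    using D_isotropic[OF X X] by (simp add: G_def J0_frame \<omega>_simps)
qed

lemma G_symmetric: "G u v = G v u"
proof -
  let ?F = "range X \<union> range (\<lambda>j. L (X j))"
  have *: "G a b = G b a" if "a \<in> ?F" "b \<in> ?F" for a b
    using that by (elim UnE rangeE; simp only: G_frame) (rule g_symmetric)+
  have "bilinear (\<lambda>u v. G v u)" using bilinear_G by (simp add: bilinear_def)
  then show ?thesis
    using bilinear_eq[OF bilinear_G, of "\<lambda>u v. G v u" UNIV ?F UNIV ?F u v] *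
    by (simp add: span_frame)
qed

text \<open>
  The splitting into \<open>D\<close> and \<open>N\<close> is orthogonal for \<open>G\<close>, and on the two summands \<open>G\<close> is the positive
  definite form \<open>g\<close>, transported by \<open>L\<close> in the case of \<open>D\<close>.
\<close>

lemma G_pos:
  assumes "v \<noteq> 0"
  shows "G v v > 0"
proof (rule decompose[of v])
  fix x y assume x: "x \<in> D" and y: "y \<in> N" and v: "v = x + y"
  have Ky: "(1/2) *\<^sub>R (J y + J' y) \<in> D" by (intro span_scale span_add J_N J'_N y)
  have gnn: "g u u \<ge> 0" "u \<noteq> 0 \<Longrightarrow> g u u > 0" for u
    unfolding g_diagonal using tamed[of u] by (cases "u = 0"; force simp: \<omega>_simps)+
  have xx: "G x x = g (L x) (L x)"
    unfolding sum_J_L using skew[of x "L x"] by (simp add: G_def J0_D[OF x] \<omega>_simps)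
  have yy: "G y y = g y y" by (simp add: G_def J0_N[OF y] \<omega>_simps)
  have xy: "G x y = 0" "G y x = 0"
    using N_isotropic[OF L_D[OF x] y] D_isotropic[OF Ky x] by (simp_all add: G_def J0_D[OF x] J0_N[OF y])
  have "G v v = g (L x) (L x) + g y y"
    unfolding v bilinear_ladd[OF bilinear_G] bilinear_radd[OF bilinear_G] xx yy xy by simp
  moreover have "L x \<noteq> 0 \<or> y \<noteq> 0"
  proof -
    have "x = 0" if "L x = 0" using sum_J_L[of x] by (simp add: that J_simps J'_simps)
    then show ?thesis using assms v by force
  qed
  ultimately show ?thesis
    using gnn(1)[of "L x"] gnn(1)[of y] gnn(2)[of "L x"] gnn(2)[of y] by linarith
qed

text \<open>
  The vectors \<open>P j\<close> are the \<open>X\<^sub>j\<^sup>+\<close>. A symmetric bilinear form is determined by its values on the frame, so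
  it remains to recognise the prescribed values as those of \<open>G\<close>: \<open>g\<close> is \<open>J\<close>-invariant, and \<open>g(X\<^sub>j, Y\<^sub>k)\<close> is
  \<open>\<omega>(X\<^sub>k, X\<^sub>j) = 0\<close>.
\<close>

lemma frame_metric_eq_G:
  assumes P: "\<And>j. J (P j) = L (X j)"
  shows "(THE H. inner_product_form H \<and> (\<forall>j k.
     H (X j) (X k) = g (P j) (P k) \<and>
     H (L (X j)) (L (X k)) = g (P j) (P k) \<and>
     H (X j) (L (X k)) = g (X j) (L (X k)))) = G"
proof (rule the_equality)
  have PP: "g (P j) (P k) = g (L (X j)) (L (X k))" for j k
  proof -
    have "g (J (P j)) (J (P k)) = g (P j) (P k)" by (rule g_J)
    then show ?thesis by (simp only: P)
  qed
  have XL: "g (X j) (L (X k)) = 0" for j k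
  proof -
    have "g (X j) (L (X k)) = g (L (X k)) (X j)" by (rule g_symmetric)
    also have "\<dots> = - (1/2) * \<omega> (- 2 *\<^sub>R X k) (X j)" by (simp only: sum_J_L)
    also have "\<dots> = 0"
      using D_isotropic[of "X k" "X j"] by (simp add: \<omega>_simps span_base)
    finally show ?thesis .
  qed
  show "inner_product_form G \<and> (\<forall>j k. G (X j) (X k) = g (P j) (P k) \<and>
     G (L (X j)) (L (X k)) = g (P j) (P k) \<and> G (X j) (L (X k)) = g (X j) (L (X k)))"
    unfolding inner_product_form_def PP XL
  proof (intro conjI allI impI)
    show "bilinear G" by (rule bilinear_G)
    show "G u v = G v u" for u v by (rule G_symmetric)
    show "0 < G v v" if "v \<noteq> 0" for v using that by (rule G_pos)
  qed (rule G_frame)+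
  fix H
  assume H: "inner_product_form H \<and> (\<forall>j k. H (X j) (X k) = g (P j) (P k) \<and>
     H (L (X j)) (L (X k)) = g (P j) (P k) \<and> H (X j) (L (X k)) = g (X j) (L (X k)))"
  then have bil: "bilinear H" and sym: "H u v = H v u" for u v
    unfolding inner_product_form_def by blast+
  have 1: "H (X j) (X k) = G (X j) (X k)" for j k
    unfolding G_frame PP[symmetric] using H by blast
  have 2: "H (L (X j)) (L (X k)) = G (L (X j)) (L (X k))" for j k
    unfolding G_frame PP[symmetric] using H by blast
  have 3: "H (X j) (L (X k)) = G (X j) (L (X k))" for j k
    unfolding G_frame XL[of j k, symmetric] using H by blast
  have 4: "H (L (X j)) (X k) = G (L (X j)) (X k)" for j k
    using 3[of k j] sym[of "L (X j)" "X k"] by (simp only: G_frame)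
  let ?F = "range X \<union> range (\<lambda>j. L (X j))"
  have "H a b = G a b" if "a \<in> ?F" "b \<in> ?F" for a b
    using that by (elim UnE rangeE; simp only: 1 2 3 4)
  then have "H u v = G u v" for u v
    using bilinear_eq[OF bil bilinear_G, of UNIV ?F UNIV ?F u v] by (simp add: span_frame)
  then show "H = G" by blast
qed

lemma G_J0: "G (J0 u) v = \<omega> u v"
  by (simp add: G_def J0_J0 \<omega>_simps)

abbreviation "M k \<equiv> inv \<Phi> (0, axis k 1)"

lemma inv_\<Phi>_X: "inv \<Phi> (axis k 1, 0) = X k"
  by (rule \<Phi>_eqD) (simp add: \<Phi>_X)

lemma \<omega>_X_M: "\<omega> (X j) (M k) = (if j = k then - 1 else 0)"
  using moment[of "M k" j] by (auto simp: axis_def)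

lemma combination_eq_iff: "(\<Sum>k\<in>UNIV. c k *\<^sub>R X k) = (\<Sum>k\<in>UNIV. d k *\<^sub>R X k) \<longleftrightarrow> c = d"
proof
  assume "(\<Sum>k\<in>UNIV. c k *\<^sub>R X k) = (\<Sum>k\<in>UNIV. d k *\<^sub>R X k)"
  then have "\<Phi> (\<Sum>k\<in>UNIV. c k *\<^sub>R X k) = \<Phi> (\<Sum>k\<in>UNIV. d k *\<^sub>R X k)" by simp
  then show "c = d" unfolding \<Phi>_combination by (auto simp: vec_eq_iff)
qed simp

text \<open>
  The coordinate vectors \<open>\<partial>\<^sub>\<theta>\<close> and \<open>\<partial>\<^sub>\<mu>\<close> are \<open>\<omega>\<close>-dual, so the coefficients of a vector of \<open>D\<close> are obtained by
  pairing with the \<open>\<partial>\<^sub>\<mu>\<close>.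
\<close>

lemma D_combination:
  assumes "x \<in> D"
  shows "x = (\<Sum>k\<in>UNIV. (\<omega> (M k) x) *\<^sub>R X k)"
proof -
  have x: "x = (\<Sum>k\<in>UNIV. (fst (\<Phi> x) $ k) *\<^sub>R X k)"
    using assms by (intro \<Phi>_eqD[of x]) (simp add: \<Phi>_combination D_eq prod_eq_iff)
  have "\<omega> (M k) x = fst (\<Phi> x) $ k" for k
  proof -
    have lin: "linear (\<omega> (M k))" using bilinear by (simp add: bilinear_def)
    have "\<omega> (M k) x = \<omega> (M k) (\<Sum>k\<in>UNIV. (fst (\<Phi> x) $ k) *\<^sub>R X k)" using x by simp
    also have "\<dots> = (\<Sum>j\<in>UNIV. (fst (\<Phi> x) $ j) * \<omega> (M k) (X j))"
      by (simp add: linear_sum[OF lin] linear_scale[OF lin])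
    also have "\<dots> = (\<Sum>j\<in>UNIV. if j = k then fst (\<Phi> x) $ j else 0)"
      by (intro sum.cong refl) (simp add: skew[of "M k"] \<omega>_X_M)
    finally show ?thesis by simp
  qed
  with x show ?thesis by simp
qed

definition \<phi> :: "real ^ 'n ^ 'n" where "\<phi> = (\<chi> k j. \<omega> (M j) (J (M k)))"
definition \<phi>s :: "real ^ 'n ^ 'n" where "\<phi>s = (1/2) *\<^sub>R (\<phi> + transpose \<phi>)"

lemma M_in_N: "M k \<in> N" by simp

lemma \<phi>_unique: "(THE m. \<forall>k. J (M k) = (\<Sum>j\<in>UNIV. m $ k $ j *\<^sub>R X j)) = \<phi>"
proof (rule the_equality)
  show *: "\<forall>k. J (M k) = (\<Sum>j\<in>UNIV. \<phi> $ k $ j *\<^sub>R X j)"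
    using D_combination[OF J_N[OF M_in_N]] by (simp add: \<phi>_def)
  fix m :: "real ^ 'n ^ 'n"
  assume "\<forall>k. J (M k) = (\<Sum>j\<in>UNIV. m $ k $ j *\<^sub>R X j)"
  with * have "(\<Sum>j\<in>UNIV. m $ k $ j *\<^sub>R X j) = (\<Sum>j\<in>UNIV. \<phi> $ k $ j *\<^sub>R X j)" for k by metis
  then show "m = \<phi>" unfolding combination_eq_iff by (simp add: vec_eq_iff fun_eq_iff)
qed

text \<open>
  The adjoint relation between \<open>J\<close> and \<open>J'\<close> turns into transposition of the matrix, which is why the mean of
  the two has the symmetric part of \<open>\<phi>\<close> as its matrix.
\<close>

lemma J0_M: "J0 (M k) = (\<Sum>j\<in>UNIV. \<phi>s $ k $ j *\<^sub>R X j)"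
proof -
  have Ky: "(1/2) *\<^sub>R (J (M k) + J' (M k)) \<in> D" by (intro span_scale span_add J_N J'_N M_in_N)
  have "\<omega> (M j) ((1/2) *\<^sub>R (J (M k) + J' (M k))) = \<phi>s $ k $ j" for j
    using adjoint[of "M k" "M j"] skew[of "M j" "J' (M k)"]
    by (simp add: \<phi>s_def \<phi>_def transpose_def \<omega>_simps)
  then show ?thesis
    using D_combination[OF Ky] by (simp add: J0_N)
qed

text \<open>
  Expanding \<open>Y\<^sub>i = - \<Sum>\<^sub>j B\<^sub>i\<^sub>j \<partial>\<^sub>\<mu>\<^sub>j\<close> and applying \<open>J0\<close> gives \<open>X\<^sub>i = \<Sum>\<^sub>k (B \<phi>\<^sub>s)\<^sub>i\<^sub>k X\<^sub>k\<close>. So \<open>\<phi>\<^sub>s\<close> is invertible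
  with inverse \<open>B\<close>.
\<close>

lemma J0_X: "J0 (X k) = - (\<Sum>j\<in>UNIV. matrix_inv \<phi>s $ k $ j *\<^sub>R M j)"
proof -
  define B :: "real ^ 'n ^ 'n" where "B = (\<chi> i j. - snd (\<Phi> (L (X i))) $ j)"
  have LX: "L (X i) = - (\<Sum>j\<in>UNIV. B $ i $ j *\<^sub>R M j)" for i
  proof (rule \<Phi>_eqD)
    have "fst (\<Phi> (L (X i))) = 0" using L_D[of "X i"] by (simp add: span_base)
    then show "\<Phi> (L (X i)) = \<Phi> (- (\<Sum>j\<in>UNIV. B $ i $ j *\<^sub>R M j))"
      by (simp add: \<Phi>_simps linear_sum[OF linear_\<Phi>] B_def prod_eq_iff fst_sum snd_sum
          vec_eq_iff sum_component axis_def sum_negf if_distrib cong: if_cong)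
  qed
  have "(B ** \<phi>s) $ i $ k = mat 1 $ i $ k" for i k
  proof -
    have "(\<Sum>k\<in>UNIV. (mat 1 $ i $ k) *\<^sub>R X k) = X i"
      by (simp add: mat_def if_distrib[of "\<lambda>c. c *\<^sub>R _"] cong: if_cong)
    also have "\<dots> = - J0 (L (X i))" by (simp add: J0_frame)
    also have "\<dots> = (\<Sum>j\<in>UNIV. B $ i $ j *\<^sub>R J0 (M j))"
      unfolding LX by (simp add: linear_neg[OF linear_J0] linear_sum[OF linear_J0] linear_scale[OF linear_J0])
    also have "\<dots> = (\<Sum>k\<in>UNIV. (\<Sum>j\<in>UNIV. B $ i $ j * \<phi>s $ j $ k) *\<^sub>R X k)"
      unfolding J0_M scaleR_sum_right scaleR_sum_left by (subst sum.swap) simp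
    finally show ?thesis
      unfolding combination_eq_iff by (simp add: fun_eq_iff matrix_matrix_mult_def)
  qed
  then have "B ** \<phi>s = mat 1" by (simp add: vec_eq_iff)
  then have "matrix_inv \<phi>s = B" by (rule matrix_inv_eqI)
  then show ?thesis by (simp add: J0_frame LX)
qed

lemma J0_unique_coordinates:
  assumes "linear F" "\<And>k. F (X k) = J0 (X k)" "\<And>k. F (M k) = J0 (M k)"
  shows "F = J0"
proof
  fix v
  have "v = inv \<Phi> (\<Phi> v)" by simp
  have v: "v = (\<Sum>k\<in>UNIV. fst (\<Phi> v) $ k *\<^sub>R X k) + (\<Sum>k\<in>UNIV. snd (\<Phi> v) $ k *\<^sub>R M k)"
  proof (rule \<Phi>_eqD)
    show "\<Phi> v = \<Phi> ((\<Sum>k\<in>UNIV. fst (\<Phi> v) $ k *\<^sub>R X k) + (\<Sum>k\<in>UNIV. snd (\<Phi> v) $ k *\<^sub>R M k))"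
      unfolding \<Phi>_simps(1) \<Phi>_combination
      by (simp add: \<Phi>_simps linear_sum[OF linear_\<Phi>] prod_eq_iff fst_sum snd_sum
          vec_eq_iff sum_component axis_def if_distrib cong: if_cong)
  qed
  show "F v = J0 v"
    using assms(2,3)
    by (subst (1 2) v) (simp add: linear_add[OF assms(1)] linear_sum[OF assms(1)] linear_scale[OF assms(1)]
        linear_add[OF linear_J0] linear_sum[OF linear_J0] linear_scale[OF linear_J0])
qed

end

section \<open>Coordinates and invariant functions on a manifold\<close>

lemma smooth_on_imp_differentiable: "smooth_on f S \<Longrightarrow> x \<in> S \<Longrightarrow> f differentiable (at x)"
  unfolding smooth_on_def by (metis ck_on.simps(2))

lemma chart_at:
  assumes "smooth_atlas A"
  shows "chart_at A p \<in> A" "p \<in> fst (chart_at A p)"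
proof -
  have "\<exists>c. c \<in> A \<and> p \<in> fst c" using assms unfolding smooth_atlas_def by blast
  then have "chart_at A p \<in> A \<and> p \<in> fst (chart_at A p)"
    unfolding chart_at_def by (rule someI_ex)
  then show "chart_at A p \<in> A" "p \<in> fst (chart_at A p)" by auto
qed

lemma
  assumes "smooth_atlas A" "c \<in> A"
  shows chart_inv_chart: "q \<in> fst c \<Longrightarrow> chart_inv c (snd c q) = q"
    and open_chart_domain: "open (fst c)"
    and open_chart_image: "open W \<Longrightarrow> open (snd c ` (W \<inter> fst c))"
proof -
  have h: "homeomorphism (fst c) (snd c ` fst c) (snd c) (chart_inv c)"
    and o: "open (fst c)" "open (snd c ` fst c)"
    using assms by (auto simp: smooth_atlas_def)
  show "q \<in> fst c \<Longrightarrow> chart_inv c (snd c q) = q"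
    using h by (simp add: homeomorphism_def)
  show "open (fst c)" by fact
  show "open (snd c ` (W \<inter> fst c))" if "open W"
  proof -
    have "openin (top_of_set (snd c ` fst c)) (snd c ` (W \<inter> fst c))"
      using that o by (intro homeomorphism_imp_open_map[OF h]) (auto simp: openin_open_eq)
    then show ?thesis using o(2) by (simp add: openin_open_eq)
  qed
qed

lemma mderiv_eqI:
  "((f \<circ> chart_inv (chart_at A p)) has_derivative f') (at (snd (chart_at A p) p)) \<Longrightarrow>
    mderiv A f p = f'"
  unfolding mderiv_def by (metis frechet_derivative_at)

text \<open>
  The coordinates and their inverse, read in the preferred chart, are mutually inverse differentiable
  maps between open sets; by the chain rule the derivative of the inverse inverts the derivative.
\<close>

lemma local_coordinates_mderiv:
  assumes A: "smooth_atlas A" and x: "local_coordinates A U x" and p: "p \<in> U"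
  shows has_derivative_coordinates:
      "((x \<circ> chart_inv (chart_at A p)) has_derivative mderiv A x p) (at (snd (chart_at A p) p))"
    and linear_mderiv_coordinates: "linear (mderiv A x p)"
    and bij_mderiv_coordinates: "bij (mderiv A x p)"
proof -
  define c where "c = chart_at A p"
  have c: "c \<in> A" "p \<in> fst c" using chart_at[OF A] by (auto simp: c_def)
  have U: "open U" "open (x ` U)" and hx: "homeomorphism U (x ` U) x (inv_into U x)"
    and sx: "smooth_on (x \<circ> chart_inv c) (snd c ` (U \<inter> fst c))"
    and sy: "smooth_on (snd c \<circ> inv_into U x) (x ` (U \<inter> fst c))"
    using x c by (auto simp: local_coordinates_def smooth_fun_def)
  let ?F = "x \<circ> chart_inv c" and ?H = "snd c \<circ> inv_into U x"
  have inv_x: "q \<in> U \<Longrightarrow> inv_into U x (x q) = q" for q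
    using hx by (simp add: homeomorphism_def)
  have ci: "q \<in> fst c \<Longrightarrow> chart_inv c (snd c q) = q" for q
    using chart_inv_chart[OF A c(1)] .
  have "?F differentiable (at (snd c p))"
    using sx p c(2) by (intro smooth_on_imp_differentiable) auto
  then have F: "(?F has_derivative mderiv A x p) (at (snd c p))"
    unfolding mderiv_def c_def by (simp add: frechet_derivative_works)
  have "?H differentiable (at (x p))"
    using sy p c(2) by (intro smooth_on_imp_differentiable) auto
  then obtain H' where H: "(?H has_derivative H') (at (x p))"
    by (auto simp: differentiable_def)
  have xp: "?F (snd c p) = x p" "?H (x p) = snd c p"
    using c p by (simp_all add: ci inv_x)
  have "((?H \<circ> ?F) has_derivative (H' \<circ> mderiv A x p)) (at (snd c p))"
    using F H by (intro diff_chain_at) (simp_all add: xp del: o_apply)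
  then have "((\<lambda>z. z) has_derivative (H' \<circ> mderiv A x p)) (at (snd c p))"
    by (rule has_derivative_transform_within_open[OF _ open_chart_image[OF A c(1) U(1)]])
      (use p c in \<open>auto simp: ci inv_x\<close>)
  then have 1: "H' \<circ> mderiv A x p = (\<lambda>z. z)"
    using has_derivative_ident by (rule has_derivative_unique)
  have "((?F \<circ> ?H) has_derivative (mderiv A x p \<circ> H')) (at (x p))"
    using F H by (intro diff_chain_at) (simp_all add: xp del: o_apply)
  moreover have "open (x ` (U \<inter> fst c))"
  proof -
    have "openin (top_of_set (x ` U)) (x ` (U \<inter> fst c))"
      using U open_chart_domain[OF A c(1)]
      by (intro homeomorphism_imp_open_map[OF hx]) (auto simp: openin_open_eq)
    then show ?thesis using U(2) by (simp add: openin_open_eq)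
  qed
  ultimately have "((\<lambda>z. z) has_derivative (mderiv A x p \<circ> H')) (at (x p))"
    by (rule has_derivative_transform_within_open)
      (use p c in \<open>auto simp: ci inv_x\<close>)
  then have 2: "mderiv A x p \<circ> H' = (\<lambda>z. z)"
    using has_derivative_ident by (rule has_derivative_unique)
  show "((x \<circ> chart_inv (chart_at A p)) has_derivative mderiv A x p) (at (snd (chart_at A p) p))"
    using F by (simp add: c_def)
  show "linear (mderiv A x p)"
    using F by (rule has_derivative_linear)
  show "bij (mderiv A x p)"
    using 1 2 by (intro o_bij[of H']) (auto simp: id_def)
qed

lemma mderiv_linear_compose:
  assumes "((x \<circ> chart_inv (chart_at A p)) has_derivative mderiv A x p) (at (snd (chart_at A p) p))"
    and "bounded_linear l"
  shows "((\<lambda>q. l (x q)) \<circ> chart_inv (chart_at A p) has_derivative (\<lambda>v. l (mderiv A x p v)))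
    (at (snd (chart_at A p) p))"
    and "mderiv A (\<lambda>q. l (x q)) p v = l (mderiv A x p v)"
proof -
  show *: "((\<lambda>q. l (x q)) \<circ> chart_inv (chart_at A p) has_derivative (\<lambda>v. l (mderiv A x p v)))
    (at (snd (chart_at A p) p))"
    using bounded_linear.has_derivative[OF assms(2,1)] by (simp add: o_def)
  show "mderiv A (\<lambda>q. l (x q)) p v = l (mderiv A x p v)"
    using mderiv_eqI[OF *] by simp
qed

text \<open>
  Along the orbit through \<open>p\<close> the function is constant, and the fundamental field is the velocity of the
  orbit. The orbit map is differentiable because the action is smooth.
\<close>

lemma invariant_derivative_fund_vf:
  fixes act :: "complex ^ 'n \<Rightarrow> 'a::{t2_space,second_countable_topology} \<Rightarrow> 'a"
    and f :: "'a \<Rightarrow> 'w::real_normed_vector"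
  assumes A: "smooth_atlas A" and act: "smooth_torus_action A act"
    and inv: "\<And>t q. t \<in> torus \<Longrightarrow> f (act t q) = f q"
    and f: "((f \<circ> chart_inv (chart_at A p)) has_derivative f') (at (snd (chart_at A p) p))"
  shows "f' (fund_vf A act \<xi> p) = 0"
proof -
  define c where "c = chart_at A p"
  have c: "c \<in> A" "p \<in> fst c" using chart_at[OF A] by (auto simp: c_def)
  let ?orbit = "\<lambda>s. act (torus_exp (s *\<^sub>R \<xi>)) p"
  let ?\<gamma> = "\<lambda>s. snd c (?orbit s)"
  have exp_0: "torus_exp (0 :: real ^ 'n) = 1"
    by (simp add: torus_exp_def vec_eq_iff)
  have "act 1 p = p" and cont: "continuous_on UNIV (\<lambda>(\<eta>, q). act (torus_exp \<eta>) q)"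
    using act by (simp_all add: smooth_torus_action_def)
  then have orbit_0: "?orbit 0 = p" by (simp add: exp_0)
  let ?a = "\<lambda>(\<eta>, y). snd c (act (torus_exp \<eta>) (chart_inv c y))"
  have p_c: "chart_inv c (snd c p) = p" using chart_inv_chart[OF A c(1)] c(2) .
  have "smooth_on ?a {(\<eta>, y). y \<in> snd c ` fst c \<and> act (torus_exp \<eta>) (chart_inv c y) \<in> fst c}"
    using act c(1) unfolding smooth_torus_action_def by blast
  then have "?a differentiable (at (0, snd c p))"
    by (rule smooth_on_imp_differentiable) (use c orbit_0 in \<open>simp add: p_c\<close>)
  then obtain a' where a': "(?a has_derivative a') (at (0, snd c p))"
    by (auto simp: differentiable_def)
  have "((\<lambda>s. (s *\<^sub>R \<xi>, snd c p)) has_derivative (\<lambda>s. (s *\<^sub>R \<xi>, 0))) (at (0::real))"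
    by (auto intro!: derivative_eq_intros)
  then have "((?a \<circ> (\<lambda>s. (s *\<^sub>R \<xi>, snd c p))) has_derivative (a' \<circ> (\<lambda>s. (s *\<^sub>R \<xi>, 0)))) (at (0::real))"
    using a' by (intro diff_chain_at) simp_all
  then have "?\<gamma> differentiable (at 0)"
    unfolding differentiable_def by (intro exI) (simp add: o_def p_c)
  then have \<gamma>: "(?\<gamma> has_vector_derivative fund_vf A act \<xi> p) (at 0)"
    unfolding fund_vf_def c_def[symmetric] by (simp add: vector_derivative_works)
  have "continuous_on UNIV ((\<lambda>(\<eta>, q). act (torus_exp \<eta>) q) \<circ> (\<lambda>s. (s *\<^sub>R \<xi>, p)))"
    by (intro continuous_on_compose continuous_intros continuous_on_subset[OF cont]) simp
  then have "continuous_on UNIV ?orbit" by (simp add: o_def)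
  \<comment> \<open>the chart inverts only on its domain, which the orbit does not leave for small \<open>s\<close>\<close>
  then have op: "open (?orbit -` fst c)"
    by (rule open_vimage[OF open_chart_domain[OF A c(1)]])
  have "((f \<circ> chart_inv c) has_derivative f') (at (?\<gamma> 0))"
    using f by (simp only: c_def[symmetric] orbit_0)
  then have "((f \<circ> chart_inv c) \<circ> ?\<gamma> has_derivative
      f' \<circ> (\<lambda>s. s *\<^sub>R fund_vf A act \<xi> p)) (at 0)"
    using \<gamma> unfolding has_vector_derivative_def by (intro diff_chain_at)
  then have "((\<lambda>s. f p) has_derivative f' \<circ> (\<lambda>s. s *\<^sub>R fund_vf A act \<xi> p)) (at (0::real))"
  proof (rule has_derivative_transform_within_open[OF _ op])
    show "0 \<in> ?orbit -` fst c" using c orbit_0 by simp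
    fix s assume "s \<in> ?orbit -` fst c"
    then have "chart_inv c (?\<gamma> s) = ?orbit s" using chart_inv_chart[OF A c(1)] by simp
    moreover have "torus_exp (s *\<^sub>R \<xi>) \<in> torus" by (simp add: torus_exp_def torus_def)
    ultimately show "((f \<circ> chart_inv c) \<circ> ?\<gamma>) s = f p" using inv by simp
  qed
  then have "f' \<circ> (\<lambda>s. s *\<^sub>R fund_vf A act \<xi> p) = (\<lambda>s. 0)"
    using has_derivative_const by (rule has_derivative_unique)
  from fun_cong[OF this, of 1] show ?thesis by simp
qed

section \<open>Tangent spaces of the open part\<close>

text \<open>
  Admissibility gives the \<open>d\<theta>\<close>-part of \<open>\<Phi>\<close> on the frame \<open>{X\<^sub>j, J\<^sub>+ X\<^sub>j}\<close>. The \<open>d\<mu>\<close>-part is minus the contraction of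
  \<open>\<Omega>\<close> with the fundamental fields, and it vanishes on these fields as \<open>\<mu>\<close> is invariant.
\<close>

lemma tamed_toric_frame_at:
  fixes e :: "'n::finite \<Rightarrow> real ^ 'n"
  assumes M: "compact_toric_symplectic_manifold A \<Omega> act \<mu>"
    and J: "Jp \<in> DGK A \<Omega> act \<mu> e"
    and br: "admissible_branch A act \<mu> e Jp U \<theta>"
    and p: "p \<in> U" "p \<in> open_part \<mu>"
  shows "tamed_toric_frame (\<Omega> p) (Jp p) (J_minus \<Omega> Jp p) (\<lambda>k. fund_vf A act (e k) p)
    (mderiv A (\<lambda>q. (\<theta> q, moment_coords \<mu> e q)) p)"
proof -
  let ?x = "\<lambda>q. (\<theta> q, moment_coords \<mu> e q)"
  let ?X = "\<lambda>k. fund_vf A act (e k) p"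
  have A: "smooth_atlas A" and symp: "symplectic_form A \<Omega>"
    and hamil: "hamiltonian_torus_action A \<Omega> act \<mu>"
    using M unfolding compact_toric_symplectic_manifold_def by blast+
  have form: "smooth_2form A \<Omega>" and nondeg: "(\<And>v. \<Omega> p u v = 0) \<Longrightarrow> u = 0" for u
    using symp unfolding symplectic_form_def by blast+
  have bil: "bilinear (\<Omega> p)" and skew: "\<Omega> p u v = - \<Omega> p v u" for u v
    using form unfolding smooth_2form_def by blast+
  have act: "smooth_torus_action A act" and inv: "t \<in> torus \<Longrightarrow> \<mu> (act t q) = \<mu> q"
    and ham: "\<Omega> p (fund_vf A act \<xi> p) v = - mderiv A (\<lambda>q. blinfun_apply (\<mu> q) \<xi>) p v"
    for t q \<xi> v
    using hamil unfolding hamiltonian_torus_action_def by blast+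
  have GK: "Jp \<in> GK A \<Omega> act"
    and span: "Jp p ` orbit_distribution A act e p = J_minus \<Omega> Jp p ` orbit_distribution A act e p"
    using J p(2) unfolding DGK_def by blast+
  then have "almost_complex_structure A Jp" and tame: "v \<noteq> 0 \<Longrightarrow> \<Omega> p v (Jp p v) > 0" for v
    unfolding GK_def integrable_complex_structure_def by blast+
  then have lin: "linear (Jp p)" and JJ: "Jp p (Jp p v) = - v" for v
    unfolding almost_complex_structure_def by blast+
  have x: "local_coordinates A U ?x"
    and \<theta>: "\<And>j k. mderiv A (\<lambda>q. \<theta> q $ j) p (?X k) = (if j = k then 1 else 0)"
      "\<And>j k. mderiv A (\<lambda>q. \<theta> q $ j) p (Jp p (?X k)) = 0"
    using br p(1) unfolding admissible_branch_def by blast+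
  note D = has_derivative_coordinates[OF A x p(1)]
  have bl: "bounded_linear (\<lambda>z::(real^'n)\<times>(real^'n). fst z $ j)"
    "bounded_linear (\<lambda>z::(real^'n)\<times>(real^'n). snd z $ j)" for j
    by (intro bounded_linear_compose[OF bounded_linear_vec_nth] bounded_linear_fst bounded_linear_snd)+
  \<comment> \<open>\<open>\<theta>\<^sub>j\<close> and \<open>\<mu>\<^sub>j\<close> are linear functions of the coordinates, so their differentials are components of \<open>\<Phi>\<close>\<close>
  have fst: "fst (mderiv A ?x p v) $ j = mderiv A (\<lambda>q. \<theta> q $ j) p v" for v j
    using mderiv_linear_compose(2)[OF D bl(1)] by simp
  have snd: "snd (mderiv A ?x p v) $ j = mderiv A (\<lambda>q. blinfun_apply (\<mu> q) (e j)) p v" for v j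
    using mderiv_linear_compose(2)[OF D bl(2), of j v] by (simp add: moment_coords_def)
  show ?thesis
  proof (rule tamed_toric_frame.intro)
    show "\<Omega> p u v = - \<Omega> p v u" for u v by (rule skew)
    show "\<Omega> p (J_minus \<Omega> Jp p u) v = - \<Omega> p u (Jp p v)" for u v
    proof -
      have "linear (\<lambda>v. \<Omega> p u (Jp p v))"
        using linear_compose[OF lin, of "\<Omega> p u"] bil by (simp add: bilinear_def o_def)
      from sharp_works[OF bil nondeg this]
      show ?thesis by (simp add: J_minus_def bilinear_lneg[OF bil])
    qed
    show "mderiv A ?x p (?X k) = (axis k 1, 0)" for k
    proof -
      have "snd (mderiv A ?x p (?X k)) $ j = 0" for j
        by (rule invariant_derivative_fund_vf[OF A act _ mderiv_linear_compose(1)[OF D bl(2)]])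
          (simp add: moment_coords_def inv)
      then show ?thesis by (auto simp: prod_eq_iff vec_eq_iff fst \<theta> axis_def)
    qed
    show "fst (mderiv A ?x p (Jp p (?X k))) = 0" for k
      by (simp add: vec_eq_iff fst \<theta>)
    show "snd (mderiv A ?x p v) $ j = - \<Omega> p (?X j) v" for v j
      by (simp add: snd ham)
    show "Jp p ` span (range ?X) = J_minus \<Omega> Jp p ` span (range ?X)"
      using span by (simp add: orbit_distribution_def)
    show "linear (mderiv A ?x p)" "bij (mderiv A ?x p)"
      using linear_mderiv_coordinates[OF A x p(1)] bij_mderiv_coordinates[OF A x p(1)] .
      show "0 < \<Omega> p v (Jp p v)" if "v \<noteq> 0" for v using that by (rule tame)
  qed (rule bil lin JJ)+
qed

section \<open>The two complex structures and the Kaehler form\<close>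

theorem theorem4p4:
  fixes A :: "('a::{t2_space,second_countable_topology}, 'e::euclidean_space) chart set"
    and \<Omega> :: "'a \<Rightarrow> 'e \<Rightarrow> 'e \<Rightarrow> real"
    and act :: "complex ^ 'n \<Rightarrow> 'a \<Rightarrow> 'a"
    and \<mu> :: "'a \<Rightarrow> (real ^ 'n) \<Rightarrow>\<^sub>L real"
    and e :: "'n \<Rightarrow> real ^ 'n"
    and Jp :: "'a \<Rightarrow> 'e \<Rightarrow> 'e"
    and C :: "('a set \<times> ('a \<Rightarrow> real ^ 'n)) set"
  assumes "compact_toric_symplectic_manifold A \<Omega> act \<mu>"
    and "lie_basis e"
    and "Jp \<in> DGK A \<Omega> act \<mu> e"
    and "admissible_coordinates A act \<mu> e Jp C"
  shows "(\<forall>p\<in>open_part \<mu>.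
            complexified_action_structure A \<Omega> act e Jp p = averaged_structure A \<mu> e Jp C p) \<and>
         (\<forall>p\<in>open_part \<mu>. kaehler_form A \<Omega> act e Jp p = \<Omega> p)"
proof -
  let ?J0 = "complexified_action_structure A \<Omega> act e Jp"
  have "?J0 p = averaged_structure A \<mu> e Jp C p \<and> kaehler_form A \<Omega> act e Jp p = \<Omega> p"
    if p: "p \<in> open_part \<mu>" for p
  proof -
    let ?X = "\<lambda>k. fund_vf A act (e k) p"
    let ?\<Phi> = "\<lambda>\<theta>. mderiv A (\<lambda>q. (\<theta> q, moment_coords \<mu> e q)) p"
    have frame: "tamed_toric_frame (\<Omega> p) (Jp p) (J_minus \<Omega> Jp p) ?X (?\<Phi> \<theta>)"
      if "(U, \<theta>) \<in> C" "p \<in> U" for U \<theta>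
      using assms that p
      by (intro tamed_toric_frame_at) (auto simp: admissible_coordinates_def)
    have "p \<in> (\<Union>(U, \<theta>)\<in>C. U)"
      using assms(4) p by (simp add: admissible_coordinates_def)
    then obtain U0 \<theta>0 where C0: "(U0, \<theta>0) \<in> C" "p \<in> U0" by auto
    interpret F: tamed_toric_frame "\<Omega> p" "Jp p" "J_minus \<Omega> Jp p" ?X "?\<Phi> \<theta>0"
      using frame[OF C0] .
    have Y: "Y_field A \<Omega> act e Jp j p = F.L (?X j)" for j
      unfolding Y_field_def X_plus_def gk_metric_def[abs_def] gk_bform_def[abs_def]
      by (rule F.J_sharp_shift_eq_L)
    have X_plus: "Jp p (X_plus A \<Omega> act e Jp j p) = F.L (?X j)" for j
      using Y by (simp add: Y_field_def)
    have J0: "?J0 p = F.J0"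
      unfolding complexified_action_structure_def Y by (rule F.frame_structure_eq_J0)
    \<comment> \<open>\<open>J0\<close> is given by its values on the frame, which do not mention coordinates; so it satisfies
      the equations of the averaged structure for every branch at \<open>p\<close>\<close>
    have coordinates: "?J0 p (d_theta A \<mu> e \<theta> k p) =
          - (\<Sum>j\<in>UNIV. matrix_inv (phi_s A \<mu> e Jp \<theta> p) $ k $ j *\<^sub>R d_mu A \<mu> e \<theta> j p)"
        "?J0 p (d_mu A \<mu> e \<theta> k p) =
          (\<Sum>j\<in>UNIV. phi_s A \<mu> e Jp \<theta> p $ k $ j *\<^sub>R d_theta A \<mu> e \<theta> j p)"
      if "(U, \<theta>) \<in> C" "p \<in> U" for U \<theta> k
    proof -
      interpret B: tamed_toric_frame "\<Omega> p" "Jp p" "J_minus \<Omega> Jp p" ?X "?\<Phi> \<theta>"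
        using frame[OF that] .
      have "?J0 p = B.J0"
        unfolding complexified_action_structure_def Y by (rule B.frame_structure_eq_J0)
      moreover have X: "d_theta A \<mu> e \<theta> k p = ?X k" for k
        by (simp add: d_theta_def coord_vec_def B.inv_\<Phi>_X)
      moreover have M: "d_mu A \<mu> e \<theta> k p = B.M k" for k
        by (simp add: d_mu_def coord_vec_def)
      moreover have "phi_s A \<mu> e Jp \<theta> p = B.\<phi>s"
        unfolding phi_s_def phi_def X M B.\<phi>_unique B.\<phi>s_def ..
      ultimately show "?J0 p (d_theta A \<mu> e \<theta> k p) =
          - (\<Sum>j\<in>UNIV. matrix_inv (phi_s A \<mu> e Jp \<theta> p) $ k $ j *\<^sub>R d_mu A \<mu> e \<theta> j p)"
        "?J0 p (d_mu A \<mu> e \<theta> k p) =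
          (\<Sum>j\<in>UNIV. phi_s A \<mu> e Jp \<theta> p $ k $ j *\<^sub>R d_theta A \<mu> e \<theta> j p)"
        by (simp_all only: B.J0_X B.J0_M)
    qed
    have "averaged_structure A \<mu> e Jp C p = ?J0 p"
      unfolding averaged_structure_def
    proof (rule the_equality)
      show "linear (?J0 p) \<and> (\<forall>(U, \<theta>)\<in>C. p \<in> U \<longrightarrow> (\<forall>k.
        ?J0 p (d_theta A \<mu> e \<theta> k p) =
          - (\<Sum>j\<in>UNIV. matrix_inv (phi_s A \<mu> e Jp \<theta> p) $ k $ j *\<^sub>R d_mu A \<mu> e \<theta> j p) \<and>
        ?J0 p (d_mu A \<mu> e \<theta> k p) =
          (\<Sum>j\<in>UNIV. phi_s A \<mu> e Jp \<theta> p $ k $ j *\<^sub>R d_theta A \<mu> e \<theta> j p)))"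
        using coordinates F.linear_J0 unfolding J0 by blast
      fix K
      assume K: "linear K \<and> (\<forall>(U, \<theta>)\<in>C. p \<in> U \<longrightarrow> (\<forall>k.
        K (d_theta A \<mu> e \<theta> k p) =
          - (\<Sum>j\<in>UNIV. matrix_inv (phi_s A \<mu> e Jp \<theta> p) $ k $ j *\<^sub>R d_mu A \<mu> e \<theta> j p) \<and>
        K (d_mu A \<mu> e \<theta> k p) =
          (\<Sum>j\<in>UNIV. phi_s A \<mu> e Jp \<theta> p $ k $ j *\<^sub>R d_theta A \<mu> e \<theta> j p)))"
      \<comment> \<open>conversely a single branch already determines the averaged structure\<close>
      then have "K (d_theta A \<mu> e \<theta>0 k p) = ?J0 p (d_theta A \<mu> e \<theta>0 k p)"
        "K (d_mu A \<mu> e \<theta>0 k p) = ?J0 p (d_mu A \<mu> e \<theta>0 k p)" for k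
        using coordinates[OF C0] C0 by fastforce+
      then show "K = ?J0 p"
        unfolding J0 using K
        by (intro F.J0_unique_coordinates) (auto simp: d_theta_def d_mu_def coord_vec_def F.inv_\<Phi>_X)
    qed
    moreover have "tilde_metric A \<Omega> act e Jp p = F.G"
      unfolding tilde_metric_def Y gk_metric_def[abs_def] by (rule F.frame_metric_eq_G[OF X_plus])
    then have "kaehler_form A \<Omega> act e Jp p = \<Omega> p"
      unfolding kaehler_form_def J0 by (simp add: fun_eq_iff F.G_J0)
    ultimately show ?thesis by simp
  qed
  then show ?thesis by blast
qed

end
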